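(* Let $(G,X,\Phi)$ be a dynamical system where $G$ is a finitely generated free group with at least two generators, $\Phi$ is uniformly continuous, $X$ is a metric space, and $N\in X$ is a non-isolated point of $X$ which is an expansive point for $\Phi_g$ for some $g\in G$. If there exists a non-empty connected set $M\subset X$, invariant for the action $\Phi$, with $M\subset\overline{O(N)}$, then $\Phi$ does not have the shadowing property.
   Context: A dynamical system $(G,X,\Phi)$ consists of a (discrete) group $G$, a metric space $(X,d)$ and a continuous map $\Phi:G\times X\to X$ with $\Phi(g_1,\Phi(g_2,x))=\Phi(g_1g_2,x)$ for all $g_1,g_2\in G$, $x\in X$, such that each $\Phi_g=\Phi(g,\cdot):X\to X$ is a homeomorphism. The orbit of $x$ is $O(x)=\{\Phi_g(x):g\in G\}$. A set $M$ is invariant if $\Phi_g(M)=M$ for all $g\in G$. A finite symmetric generator of $G$ is a finite generating set $S\subset G$ with $s^{-1}\in S$ for all $s\in S$. It is uniformly continuous (for $\Phi$) if for every $\varepsilon>0$ there is $\delta>0$ such that $d(x,y)<\delta$ implies $d(\Phi_s(x),\Phi_s(y))<\varepsilon$ for every $s\in S$; the action $\Phi$ is uniformly continuous if $G$ has a uniformly continuous finite symmetric generator $S$. Fix such an $S$ (the shadowing property below does not depend on this choice). For $\delta>0$, a family $\{x_g\}_{g\in G}\subset X$ is a $\delta$-pseudotrajectory if $d(\Phi_s(x_g),x_{sg})<\delta$ for all $g\in G$ and all $s\in S$. The action $\Phi$ has the shadowing property if for every $\varepsilon>0$ there exists $\delta>0$ such that for every $\delta$-pseudotrajectory $\{x_g\}$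 there exists $y\in X$ with $d(x_g,\Phi_g(y))<\varepsilon$ for all $g\in G$. A point $N\in X$ is an expansive point for $g\in G$ (equivalently, for $\Phi_g$) if there exists $\alpha>0$ such that for any $\delta>0$, if $0<d(y,N)<\delta$, then there exists $n\in\mathbb{Z}$ such that $d(\Phi_{g^n}(y),\Phi_{g^n}(N))>\alpha$. *)

theory Defs
  imports "HOL-Analysis.Analysis" "HOL-Algebra.Generated_Groups"
begin

text \<open>
  The metric space \<open>X\<close> is the whole type \<open>'x::metric_space\<close>; the group is a HOL-Algebra structure, so
  the action \<open>\<Phi>\<close> and families indexed by the group are only meaningful on \<open>carrier G\<close>.
\<close>

definition dynamical_system :: "('g, 'b) monoid_scheme \<Rightarrow> ('g \<Rightarrow> 'x::metric_space \<Rightarrow> 'x) \<Rightarrow> bool"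
  where "dynamical_system G \<Phi> \<longleftrightarrow>
    group G \<and>
    continuous_map (prod_topology (discrete_topology (carrier G)) euclidean) euclidean
      (\<lambda>(g, x). \<Phi> g x) \<and>
    (\<forall>g1\<in>carrier G. \<forall>g2\<in>carrier G. \<forall>x. \<Phi> g1 (\<Phi> g2 x) = \<Phi> (g1 \<otimes>\<^bsub>G\<^esub> g2) x) \<and>
    (\<forall>g\<in>carrier G. \<exists>\<psi>. homeomorphism UNIV UNIV (\<Phi> g) \<psi>)"

definition orbit :: "('g, 'b) monoid_scheme \<Rightarrow> ('g \<Rightarrow> 'x \<Rightarrow> 'x) \<Rightarrow> 'x \<Rightarrow> 'x set"
  where "orbit G \<Phi> x = {\<Phi> g x | g. g \<in> carrier G}"

definition invariant_set :: "('g, 'b) monoid_scheme \<Rightarrow> ('g \<Rightarrow> 'x \<Rightarrow> 'x) \<Rightarrow> 'x set \<Rightarrow> bool"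
  where "invariant_set G \<Phi> M \<longleftrightarrow> (\<forall>g\<in>carrier G. \<Phi> g ` M = M)"

definition finite_symmetric_generator :: "('g, 'b) monoid_scheme \<Rightarrow> 'g set \<Rightarrow> bool"
  where "finite_symmetric_generator G S \<longleftrightarrow>
    finite S \<and> S \<subseteq> carrier G \<and> generate G S = carrier G \<and> (\<forall>s\<in>S. inv\<^bsub>G\<^esub> s \<in> S)"

definition uniformly_continuous_generator ::
    "('g, 'b) monoid_scheme \<Rightarrow> ('g \<Rightarrow> 'x::metric_space \<Rightarrow> 'x) \<Rightarrow> 'g set \<Rightarrow> bool"
  where "uniformly_continuous_generator G \<Phi> S \<longleftrightarrow>
    finite_symmetric_generator G S \<and>
    (\<forall>\<epsilon>>0. \<exists>\<delta>>0. \<forall>x y. dist x y < \<delta> \<longrightarrow> (\<forall>s\<in>S. dist (\<Phi> s x) (\<Phi> s y) < \<epsilon>))"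

definition pseudotrajectory ::
    "('g, 'b) monoid_scheme \<Rightarrow> ('g \<Rightarrow> 'x::metric_space \<Rightarrow> 'x) \<Rightarrow> 'g set \<Rightarrow> real \<Rightarrow> ('g \<Rightarrow> 'x) \<Rightarrow> bool"
  where "pseudotrajectory G \<Phi> S \<delta> x \<longleftrightarrow>
    (\<forall>g\<in>carrier G. \<forall>s\<in>S. dist (\<Phi> s (x g)) (x (s \<otimes>\<^bsub>G\<^esub> g)) < \<delta>)"

definition shadowing_property ::
    "('g, 'b) monoid_scheme \<Rightarrow> ('g \<Rightarrow> 'x::metric_space \<Rightarrow> 'x) \<Rightarrow> 'g set \<Rightarrow> bool"
  where "shadowing_property G \<Phi> S \<longleftrightarrow>
    (\<forall>\<epsilon>>0. \<exists>\<delta>>0. \<forall>x. pseudotrajectory G \<Phi> S \<delta> x \<longrightarrow>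
      (\<exists>y. \<forall>g\<in>carrier G. dist (x g) (\<Phi> g y) < \<epsilon>))"

definition expansive_point ::
    "('g, 'b) monoid_scheme \<Rightarrow> ('g \<Rightarrow> 'x::metric_space \<Rightarrow> 'x) \<Rightarrow> 'g \<Rightarrow> 'x \<Rightarrow> bool"
  where "expansive_point G \<Phi> g N \<longleftrightarrow>
    (\<exists>\<alpha>>0. \<forall>\<delta>>0. \<forall>y. 0 < dist y N \<and> dist y N < \<delta> \<longrightarrow>
      (\<exists>n::int. dist (\<Phi> (g [^]\<^bsub>G\<^esub> n) y) (\<Phi> (g [^]\<^bsub>G\<^esub> n) N) > \<alpha>))"

text \<open>
  A word is a list of signed letters: \<open>(b, True)\<close> stands for \<open>b\<close> and \<open>(b, False)\<close> for its inverse.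
  A set \<open>B\<close> is a free basis of \<open>G\<close> if every element of \<open>G\<close> is the value of exactly one reduced word
  in the letters \<open>B\<close>, i.e. evaluation identifies \<open>G\<close> with the free group on \<open>B\<close>.
\<close>

primrec word_value :: "('g, 'b) monoid_scheme \<Rightarrow> ('g \<times> bool) list \<Rightarrow> 'g"
  where
    "word_value G [] = \<one>\<^bsub>G\<^esub>"
  | "word_value G (l # w) =
      (if snd l then fst l else inv\<^bsub>G\<^esub> (fst l)) \<otimes>\<^bsub>G\<^esub> word_value G w"

definition reduced_word :: "('g \<times> bool) list \<Rightarrow> bool"
  where "reduced_word w \<longleftrightarrow>
    (\<forall>i. Suc i < length w \<longrightarrow> \<not> (fst (w ! i) = fst (w ! Suc i) \<and> snd (w ! i) \<noteq> snd (w ! Suc i)))"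

definition free_basis :: "('g, 'b) monoid_scheme \<Rightarrow> 'g set \<Rightarrow> bool"
  where "free_basis G B \<longleftrightarrow>
    B \<subseteq> carrier G \<and>
    bij_betw (word_value G) {w. w \<in> lists (B \<times> UNIV) \<and> reduced_word w} (carrier G)"

end

theory Submission imports Defs "HOL-Library.Sublist" begin

text \<open>
  Idea. Cayley graphs of free groups are trees, so two exact trajectories that are close at one edge
  can be glued along it to a pseudotrajectory. If the half-tree beyond the edge misses the axis
  \<open>\<langle>g\<rangle>\<close>, expansivity forces the shadowing point to be \<open>N\<close> itself: every point near \<open>h N\<close> stays near
  \<open>h N\<close> on each half-tree missed by the line \<open>h\<langle>g\<rangle>\<close>. As \<open>N\<close> is not isolated, this cannot happen on
  the whole tree, hence if \<open>h N\<close> and \<open>q N\<close> are very close, the lines \<open>h\<langle>g\<rangle>\<close> and \<open>q\<langle>g\<rangle>\<close> reach into a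
  common half-tree far away from the root.

  Each \<open>h\<close> is coloured by the direction at the root in which \<open>h\<langle>g\<rangle>\<close> lies; a line through the root
  gets one of its two directions, depending on the position of \<open>h\<close> on it. This position dependence
  can be chosen so that orbit points that are close have the same colour: points near other lines
  in the positive (negative) direction of the axis are stable under positive (negative) powers of
  \<open>g\<close>, which leaves only finitely many positions to be separated. The colour is then constant near
  the connected set \<open>M\<close>; but \<open>M\<close> is invariant, and translations by short words change colours.
\<close>

section \<open>Reduced words and free groups\<close>

definition flip :: "'g \<times> bool \<Rightarrow> 'g \<times> bool"
  where "flip l = (fst l, \<not> snd l)"

lemma flip_simps [simp]:
  "flip (flip l) = l" "fst (flip l) = fst l" "flip l \<noteq> l" "l \<noteq> flip l" "flip k = flip l \<longleftrightarrow> k = l"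
  by (auto simp: flip_def prod_eq_iff)

definition winv :: "('g \<times> bool) list \<Rightarrow> ('g \<times> bool) list"
  where "winv w = rev (map flip w)"

lemma winv_simps [simp]:
  "winv [] = []" "winv (u @ w) = winv w @ winv u" "winv (winv w) = w" "length (winv w) = length w"
  "winv w = [] \<longleftrightarrow> w = []" "winv (l # w) = winv w @ [flip l]"
  by (auto simp: winv_def rev_map o_def)

lemma hd_winv: "w \<noteq> [] \<Longrightarrow> hd (winv w) = flip (last w)"
  and last_winv: "w \<noteq> [] \<Longrightarrow> last (winv w) = flip (hd w)"
  by (auto simp: winv_def hd_rev last_rev last_map hd_map)

lemma reduced_word_successively: "reduced_word w \<longleftrightarrow> successively (\<lambda>x y. y \<noteq> flip x) w"
  unfolding reduced_word_def successively_conv_nth by (auto simp: flip_def prod_eq_iff)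

lemma reduced_append:
  "reduced_word (u @ w) \<longleftrightarrow>
    reduced_word u \<and> reduced_word w \<and> (u = [] \<or> w = [] \<or> hd w \<noteq> flip (last u))"
  by (auto simp: reduced_word_successively successively_append_iff)

lemma reduced_Nil [simp]: "reduced_word []"
  by (simp add: reduced_word_def)

lemma reduced_single [simp]: "reduced_word [l]"
  by (simp add: reduced_word_def)

lemma reduced_Cons: "reduced_word (l # w) \<longleftrightarrow> reduced_word w \<and> (w = [] \<or> hd w \<noteq> flip l)"
  using reduced_append[of "[l]" w] by auto

lemma reduced_winv [simp]: "reduced_word (winv w) \<longleftrightarrow> reduced_word w"
proof -
  have *: "reduced_word (winv w)" if "reduced_word w" for w :: "('g \<times> bool) list"
    using that
  proof (induction w)
    case (Cons l w)
    then show ?case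
      by (cases "w = []") (auto simp: reduced_append reduced_Cons last_winv)
  qed auto
  show ?thesis using *[of w] *[of "winv w"] by auto
qed

text \<open>First and last letter of such a word are inverse to each other, so stripping both leaves
  a shorter self-inverse word. Once that is empty, two adjacent inverse letters remain, which a
  reduced word forbids.\<close>

lemma reduced_eq_winv:
  assumes "reduced_word w" "winv w = w" shows "w = []"
  using assms
proof (induction "length w" arbitrary: w rule: less_induct)
  case less
  show ?case
  proof (cases w)
    case (Cons l w1)
    have eq: "winv w1 @ [flip l] = l # w1" using less.prems(2) Cons by (simp only: winv_simps)
    show ?thesis
    proof (cases w1 rule: rev_cases)
      case Nil
      then show ?thesis using eq by simp
    next
      case (snoc w2 k)
      have k: "flip k = l" and w2: "winv w2 = w2"
        using eq snoc by auto
      have red: "reduced_word w2" "w2 @ [k] = [] \<or> hd (w2 @ [k]) \<noteq> flip l"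
        using less.prems(1) unfolding Cons snoc reduced_Cons by (auto simp: reduced_append)
      have "w2 = []" using less.hyps[OF _ red(1) w2] Cons snoc by simp
      then show ?thesis using red(2) k by auto
    qed
  qed simp
qed

text \<open>Maximal cancellation at the seam: \<open>winv c\<close> at the end of \<open>x\<close>
  meets \<open>c\<close> at the start of \<open>y\<close>, and the remains join without cancelling.
  The induction peels off the last letter of \<open>x\<close>.\<close>

lemma reduced_product:
  assumes "reduced_word x" "reduced_word y"
  shows "\<exists>x' c y'. x = x' @ winv c \<and> y = c @ y' \<and> reduced_word (x' @ y')"
  using assms
proof (induction x arbitrary: y rule: rev_induct)
  case Nil
  then show ?case by (intro exI[of _ "[]"] exI[of _ y]) auto
next
  case (snoc l x)
  show ?case
  proof (cases "y \<noteq> [] \<and> hd y = flip l")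
    case True
    then obtain y1 where y: "y = flip l # y1" by (cases y) auto
    obtain x' c y' where *: "x = x' @ winv c" "y1 = c @ y'" "reduced_word (x' @ y')"
      using snoc.IH[of y1] snoc.prems y by (auto simp: reduced_append reduced_Cons)
    show ?thesis
      using * y by (intro exI[of _ x'] exI[of _ "flip l # c"] exI[of _ y']) auto
  next
    case False
    then have "reduced_word ((x @ [l]) @ y)"
      using snoc.prems unfolding reduced_append[of "x @ [l]"] by auto
    then show ?thesis
      by (intro exI[of _ "x @ [l]"] exI[of _ "[]"] exI[of _ y]) auto
  qed
qed

text \<open>Reducedness is a condition on adjacent letters, and every seam in a power of
  \<open>r\<close> already occurs in \<open>r @ r\<close>.\<close>

lemma reduced_power:
  assumes "reduced_word (r @ r)"
  shows "reduced_word (concat (replicate k r))"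
proof (cases "r = []")
  case False
  have "reduced_word (concat (replicate k r)) \<and>
     (k > 0 \<longrightarrow> concat (replicate k r) \<noteq> [] \<and> hd (concat (replicate k r)) = hd r)"
    by (induction k) (use assms False in \<open>auto simp: reduced_append\<close>)
  then show ?thesis by blast
qed simp

lemma concat_replicate_add:
  "concat (replicate (m + n) r) = concat (replicate m r) @ concat (replicate n r)"
  by (simp add: replicate_add)

text \<open>Extracts one threshold for finitely many conditions that survive shrinking it; all
  uniform choices of constants over words or group elements come from here.\<close>

lemma finite_uniform_positive:
  fixes Q :: "'a \<Rightarrow> real \<Rightarrow> bool"
  assumes "finite A" and "\<And>a. a \<in> A \<Longrightarrow> \<exists>d>0. Q a d"
    and mono: "\<And>a d d'. Q a d \<Longrightarrow> 0 < d' \<Longrightarrow> d' \<le> d \<Longrightarrow> Q a d'"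
  shows "\<exists>d>0. \<forall>a\<in>A. Q a d"
  using assms(1,2)
proof (induction A rule: finite_induct)
  case empty
  then show ?case by (auto intro: exI[of _ 1])
next
  case (insert a A)
  obtain d1 d2 where "d1 > 0" "Q a d1" "d2 > 0" "\<forall>a\<in>A. Q a d2"
    using insert by (metis insertCI)
  then show ?case
    by (intro exI[of _ "min d1 d2"]) (auto intro: mono)
qed

section \<open>Normal forms in a free group\<close>

locale free_group = group G for G (structure) +
  fixes B :: "'a set"
  assumes free_basis: "free_basis G B"
begin

abbreviation "val \<equiv> word_value G"
abbreviation "letters \<equiv> B \<times> (UNIV :: bool set)"

definition nf :: "'a \<Rightarrow> ('a \<times> bool) list"
  where "nf = the_inv_into {w. w \<in> lists letters \<and> reduced_word w} val"

lemma basis_carrier: "B \<subseteq> carrier G"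
  using free_basis by (simp add: free_basis_def)

lemma val_bij: "bij_betw val {w. w \<in> lists letters \<and> reduced_word w} (carrier G)"
  using free_basis by (simp add: free_basis_def)

lemma val_closed [simp]: "w \<in> lists letters \<Longrightarrow> val w \<in> carrier G"
  by (induction w) (use basis_carrier in auto)

lemma nf_val: "w \<in> lists letters \<Longrightarrow> reduced_word w \<Longrightarrow> nf (val w) = w"
  unfolding nf_def by (rule the_inv_into_f_f) (use val_bij in \<open>auto simp: bij_betw_def\<close>)

lemma
  assumes "h \<in> carrier G"
  shows nf_lists: "nf h \<in> lists letters" and nf_reduced: "reduced_word (nf h)"
    and val_nf: "val (nf h) = h"
proof -
  have "nf h \<in> {w. w \<in> lists letters \<and> reduced_word w}"
    unfolding nf_def using val_bij assms by (intro the_inv_into_into) (auto simp: bij_betw_def)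
  then show "nf h \<in> lists letters" "reduced_word (nf h)" by auto
  show "val (nf h) = h"
    unfolding nf_def using val_bij assms by (intro f_the_inv_into_f) (auto simp: bij_betw_def)
qed

lemma nf_one [simp]: "nf \<one> = []"
  using nf_val[of "[]"] by simp

lemma val_append:
  "u \<in> lists letters \<Longrightarrow> w \<in> lists letters \<Longrightarrow> val (u @ w) = val u \<otimes> val w"
proof (induction u)
  case (Cons l u)
  then have "fst l \<in> carrier G" using basis_carrier by auto
  then show ?case using Cons by (auto simp: m_assoc)
qed simp

lemma winv_lists [simp]: "winv w \<in> lists letters \<longleftrightarrow> w \<in> lists letters"
  by (auto simp: winv_def flip_def in_lists_conv_set)

lemma val_winv: "w \<in> lists letters \<Longrightarrow> val (winv w) = inv (val w)"
proof (induction w)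
  case (Cons l w)
  have "val (winv (l # w)) = val (winv w) \<otimes> val [flip l]"
    using Cons.prems by (subst winv_simps(6), subst val_append) (auto simp: flip_def)
  moreover have "val [flip l] = inv (if snd l then fst l else inv (fst l))"
    using Cons.prems basis_carrier by (auto simp: flip_def)
  moreover have "fst l \<in> carrier G" "val w \<in> carrier G"
    using Cons.prems basis_carrier by auto
  ultimately show ?case
    using Cons by (simp add: inv_mult_group)
qed simp

lemma nf_inv: "h \<in> carrier G \<Longrightarrow> nf (inv h) = winv (nf h)"
  by (metis nf_lists nf_reduced nf_val reduced_winv val_nf val_winv winv_lists)

lemma nf_mult_reduced:
  assumes "u \<in> lists letters" "h \<in> carrier G" "reduced_word (u @ nf h)"
  shows "nf (val u \<otimes> h) = u @ nf h"
  by (metis append_in_lists_conv assms nf_lists nf_val val_append val_nf)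

lemma nf_strip:
  assumes "h \<in> carrier G" "nf h = u @ w"
  shows "nf (inv (val u) \<otimes> h) = w"
proof -
  have uw: "u \<in> lists letters" "w \<in> lists letters" "reduced_word w"
    using nf_lists[OF assms(1)] nf_reduced[OF assms(1)] assms(2) by (auto simp: reduced_append)
  have "h = val u \<otimes> val w"
    using val_nf[OF assms(1)] assms(2) uw by (simp add: val_append)
  then have "inv (val u) \<otimes> h = val w"
    using uw by (simp flip: m_assoc)
  then show ?thesis using uw nf_val by simp
qed

text \<open>After maximal cancellation the product is \<open>x @ y\<close> with \<open>y\<close> the
  uncancelled end of \<open>r\<close>. If \<open>x\<close> is empty, a suffix of \<open>r\<close>
  remains; otherwise the first letter of \<open>h\<close> survives.\<close>

lemma nf_mult_right:
  assumes "h \<in> carrier G" "r \<in> lists letters" "reduced_word r"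
  shows "suffix (nf (h \<otimes> val r)) r \<or>
    nf h \<noteq> [] \<and> nf (h \<otimes> val r) \<noteq> [] \<and> hd (nf (h \<otimes> val r)) = hd (nf h)"
proof -
  obtain x c y where *: "nf h = x @ winv c" "r = c @ y" "reduced_word (x @ y)"
    using reduced_product[OF nf_reduced[OF assms(1)] assms(3)] by blast
  have l: "x \<in> lists letters" "c \<in> lists letters" "y \<in> lists letters"
    using nf_lists[OF assms(1)] assms(2) *
    by (metis append_in_lists_conv winv_lists)+
  have "h \<otimes> val r = (val x \<otimes> val (winv c)) \<otimes> (val c \<otimes> val y)"
    using val_nf[OF assms(1)] * l by (metis val_append winv_lists)
  also have "\<dots> = val x \<otimes> (inv (val c) \<otimes> val c) \<otimes> val y"
    using l by (simp only: val_winv m_assoc val_closed inv_closed m_closed)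
  also have "\<dots> = val (x @ y)"
    using l by (simp add: val_append)
  finally have "nf (h \<otimes> val r) = x @ y"
    using nf_val[of "x @ y"] l * by simp
  then show ?thesis
    using * by (cases "x = []") (auto simp: suffix_def)
qed

lemma nf_letter_mult:
  assumes "l \<in> letters" "h \<in> carrier G"
  shows "nf (val [l] \<otimes> h) = (if nf h \<noteq> [] \<and> hd (nf h) = flip l then tl (nf h) else l # nf h)"
proof (cases "nf h \<noteq> [] \<and> hd (nf h) = flip l")
  case True
  then have "nf h = [flip l] @ tl (nf h)" by (cases "nf h") auto
  then have "nf (inv (val [flip l]) \<otimes> h) = tl (nf h)"
    using nf_strip assms by blast
  moreover have "inv (val [flip l]) = val [l]"
    using val_winv[of "[flip l]"] assms by (auto simp: flip_def)
  ultimately show ?thesis using True by simp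
next
  case False
  then have "reduced_word ([l] @ nf h)"
    using nf_reduced[OF assms(2)] unfolding reduced_append by auto
  then show ?thesis
    using False nf_mult_reduced[of "[l]" h] assms by (auto simp del: word_value.simps)
qed

section \<open>The Cayley tree with respect to the letters\<close>

definition letter_set :: "'a set"
  where "letter_set = (\<lambda>l. val [l]) ` letters"

lemma letter_set_carrier: "letter_set \<subseteq> carrier G"
  unfolding letter_set_def by (force simp del: word_value.simps intro!: val_closed)

lemma val_in_generate: "w \<in> lists letters \<Longrightarrow> val w \<in> generate G letter_set"
proof (induction w)
  case (Cons l w)
  have "val [l] \<in> generate G letter_set"
    using Cons.prems by (intro generate.incl) (auto simp: letter_set_def simp del: word_value.simps)
  moreover have "val (l # w) = val [l] \<otimes> val w"
    using Cons.prems val_append[of "[l]" w] by (simp del: word_value.simps)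
  ultimately show ?case
    using Cons generate.eng[of "val [l]" G letter_set "val w"] by (simp del: word_value.simps)
qed (simp add: generate.one)

lemma generate_letters: "generate G letter_set = carrier G"
proof
  show "generate G letter_set \<subseteq> carrier G"
    by (rule generate_incl[OF letter_set_carrier])
  show "carrier G \<subseteq> generate G letter_set"
    by (metis nf_lists subsetI val_in_generate val_nf)
qed

lemma letter_set_inv: "t \<in> letter_set \<Longrightarrow> inv t \<in> letter_set"
proof -
  assume "t \<in> letter_set"
  then obtain l where l: "l \<in> letters" "t = val [l]" by (auto simp: letter_set_def)
  then have "inv t = val [flip l]" using val_winv[of "[l]"] by (simp del: word_value.simps)
  moreover have "flip l \<in> letters" using l by (auto simp: flip_def)
  ultimately show ?thesis by (auto simp: letter_set_def simp del: word_value.simps)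
qed

text \<open>The half-tree of all elements whose normal form ends in \<open>w\<close> is attached by a single edge.\<close>

lemma half_tree_entry:
  assumes "t \<in> letter_set" "h \<in> carrier G" "w \<in> lists letters"
    and "\<not> suffix w (nf h)" "suffix w (nf (t \<otimes> h))"
  shows "t \<otimes> h = val w"
proof -
  obtain l where l: "l \<in> letters" "t = val [l]" using assms(1) by (auto simp: letter_set_def)
  \<comment> \<open>Cancelling a letter creates no new suffix, so \<open>l\<close> is prepended; the
    suffix that is new can then only be the whole word.\<close>
  have "nf (t \<otimes> h) \<noteq> tl (nf h)"
    using assms(4,5) by (metis suffix_tl suffix_order.trans)
  then have "nf (t \<otimes> h) = l # nf h"
    using nf_letter_mult[OF l(1) assms(2)] l(2) by (metis (full_types))
  then have "w = nf (t \<otimes> h)" using assms(4,5) by (auto simp: suffix_Cons)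
  then show ?thesis
    using val_nf[of "t \<otimes> h"] assms(1,2) letter_set_carrier by auto
qed

end

section \<open>Stability on half-trees\<close>

text \<open>Translates between the half-tree of an acting element \<open>j\<close>, given by
  suffixes, and points on lines, given by prefixes of normal forms: the two are exchanged by
  inversion.\<close>

lemma prefix_winv: "prefix u (winv v) \<longleftrightarrow> suffix (winv u) v"
proof -
  have *: "suffix (winv u) v" if p: "prefix u (winv v)" for u v :: "('a \<times> bool) list"
  proof -
    obtain y where "winv v = u @ y" using p by (rule prefixE)
    then have "v = winv y @ winv u" by (metis winv_simps(2,3))
    then show ?thesis by (simp add: suffix_def)
  qed
  have "prefix u (winv v)" if "suffix (winv u) v"
    using that by (auto simp: suffix_def prefix_def)
  with * show ?thesis by blast
qed

locale shadowing_free_action = free_group G B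
  for G (structure) and B :: "'a set" +
  fixes \<Phi> :: "'a \<Rightarrow> 'x::metric_space \<Rightarrow> 'x" and S :: "'a set"
  assumes dynamical_system: "dynamical_system G \<Phi>"
    and finite_basis: "finite B"
    and generator: "uniformly_continuous_generator G \<Phi> S"
    and shadowing: "shadowing_property G \<Phi> S"
begin

section \<open>Uniform continuity and change of generator\<close>

lemma act_act [simp]:
  "g \<in> carrier G \<Longrightarrow> h \<in> carrier G \<Longrightarrow> \<Phi> g (\<Phi> h x) = \<Phi> (g \<otimes> h) x"
  using dynamical_system by (simp add: dynamical_system_def)

text \<open>The axioms only make the action of the identity idempotent; being injective as a
  homeomorphism, it is the identity map.\<close>

lemma act_one [simp]: "\<Phi> \<one> x = x"
proof -
  obtain \<psi> where "homeomorphism UNIV UNIV (\<Phi> \<one>) \<psi>"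
    using dynamical_system unfolding dynamical_system_def by blast
  then have "\<psi> (\<Phi> \<one> y) = y" for y by (simp add: homeomorphism_def)
  moreover have "\<Phi> \<one> (\<Phi> \<one> x) = \<Phi> \<one> x" by simp
  ultimately show ?thesis by metis
qed

lemma act_inv [simp]:
  "g \<in> carrier G \<Longrightarrow> \<Phi> (inv g) (\<Phi> g x) = x" "g \<in> carrier G \<Longrightarrow> \<Phi> g (\<Phi> (inv g) x) = x"
  by simp_all

lemma act_inject: "g \<in> carrier G \<Longrightarrow> \<Phi> g x = \<Phi> g y \<longleftrightarrow> x = y"
  by (metis act_inv(1))

lemma act_uniformly_continuous:
  assumes "h \<in> carrier G"
  shows "uniformly_continuous_on UNIV (\<Phi> h)"
proof -
  have S: "finite S" "S \<subseteq> carrier G" "generate G S = carrier G" "\<And>s. s \<in> S \<Longrightarrow> inv s \<in> S"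
    using generator by (auto simp: uniformly_continuous_generator_def finite_symmetric_generator_def)
  have uc: "uniformly_continuous_on UNIV (\<Phi> s)" if "s \<in> S" for s
    unfolding uniformly_continuous_on_def
  proof (intro allI impI)
    fix e :: real assume "e > 0"
    then obtain d where d: "d > 0" "\<forall>x y. dist x y < d \<longrightarrow> (\<forall>s\<in>S. dist (\<Phi> s x) (\<Phi> s y) < e)"
      using generator unfolding uniformly_continuous_generator_def by blast
    then show "\<exists>d>0. \<forall>x\<in>UNIV. \<forall>x'\<in>UNIV. dist x' x < d \<longrightarrow> dist (\<Phi> s x') (\<Phi> s x) < e"
      using that by blast
  qed
  have "h \<in> generate G S" using S assms by simp
  then show ?thesis
  proof (induction rule: generate.induct)
    case one
    have "\<Phi> \<one> = (\<lambda>x. x)" by auto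
    then show ?case by (simp add: uniformly_continuous_on_id)
  next
    case (eng h1 h2)
    have "h1 \<in> carrier G" "h2 \<in> carrier G" using eng S by auto
    then have "\<Phi> (h1 \<otimes> h2) = \<Phi> h1 \<circ> \<Phi> h2" by (auto simp: o_def)
    moreover have "uniformly_continuous_on (range (\<Phi> h2)) (\<Phi> h1)"
      using eng.IH(1) unfolding uniformly_continuous_on_def by blast
    ultimately show ?case
      using uniformly_continuous_on_compose[OF eng.IH(2)] by (simp add: o_def)
  qed (use uc S in auto)
qed

lemma act_uniform_finite:
  assumes "finite F" "F \<subseteq> carrier G" "e > 0"
  shows "\<exists>d>0. \<forall>h\<in>F. \<forall>x y. dist x y < d \<longrightarrow> dist (\<Phi> h x) (\<Phi> h y) < e"
proof (rule finite_uniform_positive[OF assms(1)])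
  fix h assume "h \<in> F"
  then show "\<exists>d>0. \<forall>x y. dist x y < d \<longrightarrow> dist (\<Phi> h x) (\<Phi> h y) < e"
    using act_uniformly_continuous[of h] assms unfolding uniformly_continuous_on_def by blast
qed auto

text \<open>Errors accumulate over a product of letters. For \<open>h1 \<otimes> h2\<close> the
  error of the \<open>h2\<close> step is pushed through the uniformly continuous map
  \<open>\<Phi> h1\<close>, so it must be below the modulus \<open>c\<close>, and each half
  contributes \<open>e/2\<close>.\<close>

lemma pseudotrajectory_step:
  assumes "h \<in> carrier G" "e > 0"
  shows "\<exists>d>0. \<forall>x. pseudotrajectory G \<Phi> letter_set d x \<longrightarrow>
    (\<forall>f\<in>carrier G. dist (\<Phi> h (x f)) (x (h \<otimes> f)) < e)"
proof -
  have "h \<in> generate G letter_set" using generate_letters assms by simp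
  then show ?thesis using assms(2)
  proof (induction arbitrary: e rule: generate.induct)
    case one
    then show ?case by (intro exI[of _ 1]) auto
  next
    case (incl h)
    then show ?case unfolding pseudotrajectory_def by blast
  next
    case (inv h)
    then show ?case using letter_set_inv unfolding pseudotrajectory_def by blast
  next
    case (eng h1 h2)
    have h: "h1 \<in> carrier G" "h2 \<in> carrier G" using eng generate_letters by auto
    obtain d1 where d1: "d1 > 0" "\<And>x f. pseudotrajectory G \<Phi> letter_set d1 x \<Longrightarrow> f \<in> carrier G \<Longrightarrow>
        dist (\<Phi> h1 (x f)) (x (h1 \<otimes> f)) < e/2"
      using eng.IH(1)[of "e/2"] eng.prems by auto
    obtain c where c: "c > 0" "\<And>x y. dist x y < c \<Longrightarrow> dist (\<Phi> h1 x) (\<Phi> h1 y) < e/2"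
      using act_uniform_finite[of "{h1}" "e/2"] eng.prems h by auto
    obtain d2 where d2: "d2 > 0" "\<And>x f. pseudotrajectory G \<Phi> letter_set d2 x \<Longrightarrow> f \<in> carrier G \<Longrightarrow>
        dist (\<Phi> h2 (x f)) (x (h2 \<otimes> f)) < c"
      using eng.IH(2)[of c] c by auto
    show ?case
    proof (intro exI[of _ "min d1 d2"] conjI allI impI ballI)
      fix x f assume pt: "pseudotrajectory G \<Phi> letter_set (min d1 d2) x" and f: "f \<in> carrier G"
      have pt: "pseudotrajectory G \<Phi> letter_set d1 x" "pseudotrajectory G \<Phi> letter_set d2 x"
        using pt by (auto simp: pseudotrajectory_def)
      have "dist (\<Phi> h1 (\<Phi> h2 (x f))) (\<Phi> h1 (x (h2 \<otimes> f))) < e/2"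
        using c d2 pt f by blast
      moreover have "dist (\<Phi> h1 (x (h2 \<otimes> f))) (x (h1 \<otimes> (h2 \<otimes> f))) < e/2"
        using d1 pt f h by simp
      moreover have "h1 \<otimes> (h2 \<otimes> f) = h1 \<otimes> h2 \<otimes> f" using f h by (simp add: m_assoc)
      moreover have "\<Phi> h1 (\<Phi> h2 (x f)) = \<Phi> (h1 \<otimes> h2) (x f)" using h by simp
      ultimately show "dist (\<Phi> (h1 \<otimes> h2) (x f)) (x (h1 \<otimes> h2 \<otimes> f)) < e"
        using dist_triangle[of "\<Phi> (h1 \<otimes> h2) (x f)" "x (h1 \<otimes> h2 \<otimes> f)" "\<Phi> h1 (x (h2 \<otimes> f))"]
        by (simp only:)
    qed (use d1 d2 in auto)
  qed
qed

text \<open>Change of generator: a sufficiently fine pseudotrajectory for the letters is one for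
  \<open>S\<close>. With the letters as generator, the Cayley graph is a tree.\<close>

lemma shadowing_letter_set: "shadowing_property G \<Phi> letter_set"
  unfolding shadowing_property_def
proof (intro allI impI)
  fix e :: real assume "e > 0"
  then obtain d where d: "d > 0" "\<And>x. pseudotrajectory G \<Phi> S d x \<Longrightarrow>
      \<exists>y. \<forall>g\<in>carrier G. dist (x g) (\<Phi> g y) < e"
    using shadowing unfolding shadowing_property_def by blast
  have S: "finite S" "S \<subseteq> carrier G"
    using generator by (auto simp: uniformly_continuous_generator_def finite_symmetric_generator_def)
  have "\<exists>c>0. \<forall>s\<in>S. \<forall>x. pseudotrajectory G \<Phi> letter_set c x \<longrightarrow>
      (\<forall>f\<in>carrier G. dist (\<Phi> s (x f)) (x (s \<otimes> f)) < d)"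
  proof (rule finite_uniform_positive[OF S(1)])
    fix s assume "s \<in> S"
    then show "\<exists>c>0. \<forall>x. pseudotrajectory G \<Phi> letter_set c x \<longrightarrow>
      (\<forall>f\<in>carrier G. dist (\<Phi> s (x f)) (x (s \<otimes> f)) < d)"
      using pseudotrajectory_step S d(1) by blast
  next
    fix s c c'
    assume "\<forall>x. pseudotrajectory G \<Phi> letter_set c x \<longrightarrow>
      (\<forall>f\<in>carrier G. dist (\<Phi> s (x f)) (x (s \<otimes> f)) < d)" "c' \<le> c"
    then show "\<forall>x. pseudotrajectory G \<Phi> letter_set c' x \<longrightarrow>
      (\<forall>f\<in>carrier G. dist (\<Phi> s (x f)) (x (s \<otimes> f)) < d)"
      unfolding pseudotrajectory_def by (meson less_le_trans)
  qed
  then obtain c where c: "c > 0" "\<And>x s f. pseudotrajectory G \<Phi> letter_set c x \<Longrightarrow> s \<in> S \<Longrightarrow>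
      f \<in> carrier G \<Longrightarrow> dist (\<Phi> s (x f)) (x (s \<otimes> f)) < d"
    by blast
  then have "pseudotrajectory G \<Phi> S d x" if "pseudotrajectory G \<Phi> letter_set c x" for x
    using that unfolding pseudotrajectory_def[of G \<Phi> S] by blast
  then show "\<exists>d>0. \<forall>x. pseudotrajectory G \<Phi> letter_set d x \<longrightarrow>
      (\<exists>y. \<forall>g\<in>carrier G. dist (x g) (\<Phi> g y) < e)"
    using c(1) d(2) by blast
qed

end

section \<open>Half-trees missed by a translate of the axis\<close>

locale expansive_orbit = shadowing_free_action G B \<Phi> S
  for G (structure) and B :: "'a set" and \<Phi> :: "'a \<Rightarrow> 'x::metric_space \<Rightarrow> 'x" and S :: "'a set" +
  fixes N :: 'x and g :: 'a and \<alpha> :: real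
  assumes g_carrier [simp]: "g \<in> carrier G"
    and alpha_pos: "\<alpha> > 0"
    and expansive: "y \<noteq> N \<Longrightarrow> \<exists>n::int. dist (\<Phi> (g [^] n) y) (\<Phi> (g [^] n) N) > \<alpha>"
    and limit_point: "N islimpt UNIV"
begin

text \<open>Glue the trajectory of \<open>z\<close> on the half-tree to that of \<open>h N\<close>
  elsewhere. The line avoids the half-tree, so the shadowing point follows \<open>h N\<close> along
  all of it and must equal \<open>h N\<close> by expansivity; on the half-tree this says that
  \<open>z\<close> stays close to \<open>h N\<close>. The threshold does not depend on
  \<open>h\<close>, since it comes only from shadowing and from the edge at
  \<open>val w\<close>.\<close>

lemma half_tree_stable:
  assumes "0 < e" "e \<le> \<alpha>" and u: "u \<in> lists letters"
  shows "\<exists>\<delta>>0. \<forall>h\<in>carrier G. (\<forall>n::int. \<not> prefix u (nf (h \<otimes> g [^] n))) \<longrightarrow>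
    (\<forall>z. dist z (\<Phi> h N) < \<delta> \<longrightarrow>
      (\<forall>j\<in>carrier G. prefix u (nf (inv j)) \<longrightarrow> dist (\<Phi> j z) (\<Phi> j (\<Phi> h N)) < e))"
proof -
  obtain d where d: "d > 0" "\<And>x. pseudotrajectory G \<Phi> letter_set d x \<Longrightarrow>
      \<exists>y. \<forall>g\<in>carrier G. dist (x g) (\<Phi> g y) < e"
    using shadowing_letter_set assms(1) unfolding shadowing_property_def by blast
  define w where "w = winv u"
  have w: "w \<in> lists letters" "val w \<in> carrier G" using u by (simp_all add: w_def)
  have pre: "prefix u (nf (inv j)) \<longleftrightarrow> suffix w (nf j)" if "j \<in> carrier G" for j
    using that by (simp add: nf_inv prefix_winv w_def)
  \<comment> \<open>These are the endpoints of the edges at which the gluing can jump: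
    \<open>val w\<close> when the half-tree is entered, \<open>t \<otimes> val w\<close> when it is
    left.\<close>
  define F where "F = insert (val w) ((\<lambda>t. t \<otimes> val w) ` letter_set)"
  have "finite F" using finite_basis by (simp add: F_def letter_set_def)
  moreover have "F \<subseteq> carrier G" using w(2) letter_set_carrier m_closed unfolding F_def by blast
  ultimately obtain c where c: "c > 0" "\<And>f x y. f \<in> F \<Longrightarrow> dist x y < c \<Longrightarrow> dist (\<Phi> f x) (\<Phi> f y) < d"
    using act_uniform_finite[of F d] d(1) by blast
  show ?thesis
  proof (intro exI[of _ c] conjI ballI impI allI)
    fix h z j
    assume h: "h \<in> carrier G" and avoid: "\<forall>n::int. \<not> prefix u (nf (h \<otimes> g [^] n))"
      and z: "dist z (\<Phi> h N) < c" and j: "j \<in> carrier G" and ju: "prefix u (nf (inv j))"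
    define x where "x f = (if suffix w (nf f) then \<Phi> f z else \<Phi> f (\<Phi> h N))" for f
    have "pseudotrajectory G \<Phi> letter_set d x"
      unfolding pseudotrajectory_def
    proof (intro ballI)
      fix f t assume f: "f \<in> carrier G" and t: "t \<in> letter_set"
      have tc: "t \<in> carrier G" using t letter_set_carrier by blast
      consider "suffix w (nf f) \<longleftrightarrow> suffix w (nf (t \<otimes> f))"
        | "\<not> suffix w (nf f)" "suffix w (nf (t \<otimes> f))" | "suffix w (nf f)" "\<not> suffix w (nf (t \<otimes> f))"
        by blast
      then show "dist (\<Phi> t (x f)) (x (t \<otimes> f)) < d"
      proof cases
        case 1
        then show ?thesis using f tc h d(1) by (simp add: x_def m_assoc)
      next
        case 2
        then have "t \<otimes> f = val w" using half_tree_entry t f w by blast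
        then have "dist (\<Phi> (t \<otimes> f) (\<Phi> h N)) (\<Phi> (t \<otimes> f) z) < d"
          using c(2)[of "val w"] z by (simp add: dist_commute F_def)
        then show ?thesis using 2 f tc h by (simp add: x_def m_assoc)
      next
        case 3
        \<comment> \<open>Leaving along \<open>t\<close> is entering along \<open>inv t\<close> from
          the other end.\<close>
        have "inv t \<otimes> (t \<otimes> f) = f" using f tc by (simp flip: m_assoc)
        then have fw: "f = val w"
          using half_tree_entry[of "inv t" "t \<otimes> f" w] letter_set_inv t f tc w 3 by simp
        then have "dist (\<Phi> (t \<otimes> f) z) (\<Phi> (t \<otimes> f) (\<Phi> h N)) < d"
          using c(2)[of "t \<otimes> val w"] z t by (simp add: F_def)
        then show ?thesis using 3 f tc h by (simp add: x_def m_assoc)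
      qed
    qed
    then obtain y where y: "\<And>f. f \<in> carrier G \<Longrightarrow> dist (x f) (\<Phi> f y) < e"
      using d(2) by blast
    \<comment> \<open>Shadowing is read off at \<open>g [^] n \<otimes> inv h\<close>. Its inverse
      lies on the line of \<open>h\<close>, so this element is outside the half-tree, where
      \<open>x\<close> follows \<open>h N\<close>.\<close>
    have "dist (\<Phi> (g [^] n) (\<Phi> (inv h) y)) (\<Phi> (g [^] n) N) \<le> \<alpha>" for n :: int
    proof -
      define f where "f = g [^] n \<otimes> inv h"
      have f: "f \<in> carrier G" using h by (simp add: f_def)
      have "inv f = h \<otimes> g [^] (- n)"
        using h by (simp add: f_def inv_mult_group int_pow_neg)
      then have "\<not> suffix w (nf f)" using pre[OF f] avoid by metis
      then have "x f = \<Phi> (g [^] n) N"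
        using h by (simp add: x_def f_def m_assoc)
      then have "dist (\<Phi> (g [^] n) N) (\<Phi> f y) < e" using y[OF f] by simp
      then show ?thesis using h assms(2) by (simp add: f_def dist_commute)
    qed
    then have "\<Phi> (inv h) y = N" using expansive by (meson not_less)
    then have "y = \<Phi> h N" using h act_inv(2) by metis
    then show "dist (\<Phi> j z) (\<Phi> j (\<Phi> h N)) < e"
      using y[OF j] ju pre[OF j] by (simp add: x_def)
  qed (rule c(1))
qed

text \<open>Otherwise each half-tree at depth \<open>R\<close> is missed by one of the two lines,
  and stability there, with uniform continuity for the finitely many short elements, keeps a
  neighbourhood of \<open>h N\<close> within \<open>\<alpha>\<close> of it under the whole group.
  Expansivity at the limit point \<open>N\<close> excludes this.\<close>

lemma near_orbit_points_share_prefix: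
  "\<exists>\<delta>>0. \<forall>h\<in>carrier G. \<forall>q\<in>carrier G. dist (\<Phi> h N) (\<Phi> q N) < \<delta> \<longrightarrow>
    (\<exists>u (n::int) (n'::int). length u = R \<and> prefix u (nf (h \<otimes> g [^] n)) \<and> prefix u (nf (q \<otimes> g [^] n')))"
proof -
  define e where "e = \<alpha> / 2"
  have e: "0 < e" "e \<le> \<alpha>" using alpha_pos by (auto simp: e_def)
  define A where "A = {u \<in> lists letters. length u = R}"
  have "finite A"
    using finite_lists_length_eq[of letters R] finite_basis by (simp add: A_def lists_eq_set)
  have "\<exists>\<delta>>0. \<forall>u\<in>A. \<forall>h\<in>carrier G. (\<forall>n::int. \<not> prefix u (nf (h \<otimes> g [^] n))) \<longrightarrow>
    (\<forall>z. dist z (\<Phi> h N) < \<delta> \<longrightarrow>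
      (\<forall>j\<in>carrier G. prefix u (nf (inv j)) \<longrightarrow> dist (\<Phi> j z) (\<Phi> j (\<Phi> h N)) < e))"
  proof (rule finite_uniform_positive[OF \<open>finite A\<close>])
    fix u assume "u \<in> A"
    then show "\<exists>\<delta>>0. \<forall>h\<in>carrier G. (\<forall>n::int. \<not> prefix u (nf (h \<otimes> g [^] n))) \<longrightarrow>
    (\<forall>z. dist z (\<Phi> h N) < \<delta> \<longrightarrow>
      (\<forall>j\<in>carrier G. prefix u (nf (inv j)) \<longrightarrow> dist (\<Phi> j z) (\<Phi> j (\<Phi> h N)) < e))"
      using half_tree_stable[OF e] by (simp add: A_def)
  next
    fix u and d d' :: real
    assume "\<forall>h\<in>carrier G. (\<forall>n::int. \<not> prefix u (nf (h \<otimes> g [^] n))) \<longrightarrow>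
    (\<forall>z. dist z (\<Phi> h N) < d \<longrightarrow>
      (\<forall>j\<in>carrier G. prefix u (nf (inv j)) \<longrightarrow> dist (\<Phi> j z) (\<Phi> j (\<Phi> h N)) < e))" "d' \<le> d"
    then show "\<forall>h\<in>carrier G. (\<forall>n::int. \<not> prefix u (nf (h \<otimes> g [^] n))) \<longrightarrow>
    (\<forall>z. dist z (\<Phi> h N) < d' \<longrightarrow>
      (\<forall>j\<in>carrier G. prefix u (nf (inv j)) \<longrightarrow> dist (\<Phi> j z) (\<Phi> j (\<Phi> h N)) < e))"
      by (meson less_le_trans)
  qed
  then obtain d1 where d1: "d1 > 0" "\<And>u h z j. u \<in> A \<Longrightarrow> h \<in> carrier G \<Longrightarrow>
     (\<forall>n::int. \<not> prefix u (nf (h \<otimes> g [^] n))) \<Longrightarrow> dist z (\<Phi> h N) < d1 \<Longrightarrow> j \<in> carrier G \<Longrightarrow>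
      prefix u (nf (inv j)) \<Longrightarrow> dist (\<Phi> j z) (\<Phi> j (\<Phi> h N)) < e"
    by blast
  define W where "W = val ` {w \<in> lists letters. length w \<le> R}"
  have "finite W"
    using finite_lists_length_le[of letters R] finite_basis by (simp add: W_def lists_eq_set)
  moreover have "W \<subseteq> carrier G" unfolding W_def using val_closed by blast
  ultimately obtain d2 where d2: "d2 > 0"
      "\<And>j x y. j \<in> W \<Longrightarrow> dist x y < d2 \<Longrightarrow> dist (\<Phi> j x) (\<Phi> j y) < e"
    using act_uniform_finite[of W e] e by blast
  show ?thesis
  proof (intro exI[of _ "min d1 d2"] conjI ballI impI)
    fix h q assume h: "h \<in> carrier G" and q: "q \<in> carrier G"
      and near: "dist (\<Phi> h N) (\<Phi> q N) < min d1 d2"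
    show "\<exists>u (n::int) (n'::int). length u = R \<and> prefix u (nf (h \<otimes> g [^] n)) \<and> prefix u (nf (q \<otimes> g [^] n'))"
    proof (rule ccontr)
      assume no: "\<not> ?thesis"
      \<comment> \<open>Subtracting the distance of the two orbit points keeps \<open>z\<close>
        within \<open>d1\<close> of \<open>\<Phi> q N\<close> as well. If only the line of
        \<open>q\<close> misses the half-tree, the comparison passes through \<open>q N\<close>,
        hence \<open>2 * e\<close>, which is \<open>\<alpha>\<close>.\<close>
      have close: "dist (\<Phi> j z) (\<Phi> j (\<Phi> h N)) < 2 * e"
        if z: "dist z (\<Phi> h N) < min d1 d2 - dist (\<Phi> h N) (\<Phi> q N)" and j: "j \<in> carrier G" for z j
      proof (cases "length (nf j) \<le> R")
        case True
        then have "j \<in> W" using val_nf[OF j] nf_lists[OF j] unfolding W_def by force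
        then show ?thesis using d2(2)[of j z "\<Phi> h N"] z e by (smt (verit) zero_le_dist)
      next
        case False
        define u where "u = take R (nf (inv j))"
        have pu: "prefix u (nf (inv j))" by (simp add: u_def take_is_prefix)
        have lu: "length u = R" using False j by (simp add: u_def nf_inv)
        have "u \<in> lists letters"
          using nf_lists[of "inv j"] j set_take_subset unfolding u_def by fastforce
        then have uA: "u \<in> A" using lu by (simp add: A_def)
        have "(\<forall>n::int. \<not> prefix u (nf (h \<otimes> g [^] n))) \<or> (\<forall>n::int. \<not> prefix u (nf (q \<otimes> g [^] n)))"
          using no lu by blast
        then show ?thesis
        proof
          assume *: "\<forall>n::int. \<not> prefix u (nf (h \<otimes> g [^] n))"
          then show ?thesis
            using d1(2)[OF uA h * _ j pu, of z] z e by (smt (verit) zero_le_dist)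
        next
          assume *: "\<forall>n::int. \<not> prefix u (nf (q \<otimes> g [^] n))"
          have "dist z (\<Phi> q N) < d1"
            using z dist_triangle[of z "\<Phi> q N" "\<Phi> h N"] by linarith
          then have "dist (\<Phi> j z) (\<Phi> j (\<Phi> q N)) < e" "dist (\<Phi> j (\<Phi> h N)) (\<Phi> j (\<Phi> q N)) < e"
            using d1(2)[OF uA q * _ j pu] near by auto
          then show ?thesis
            using dist_triangle2[of "\<Phi> j z" "\<Phi> j (\<Phi> h N)" "\<Phi> j (\<Phi> q N)"] by linarith
        qed
      qed
      obtain c where c: "c > 0" "\<And>y. dist y N < c \<Longrightarrow>
          dist (\<Phi> h y) (\<Phi> h N) < min d1 d2 - dist (\<Phi> h N) (\<Phi> q N)"
        using act_uniform_finite[of "{h}" "min d1 d2 - dist (\<Phi> h N) (\<Phi> q N)"] h near by auto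
      obtain y where y: "y \<noteq> N" "dist y N < c"
        using limit_point c(1) unfolding islimpt_approachable by blast
      obtain n :: int where n: "dist (\<Phi> (g [^] n) y) (\<Phi> (g [^] n) N) > \<alpha>"
        using expansive[OF y(1)] by blast
      have "dist (\<Phi> (g [^] n \<otimes> inv h) (\<Phi> h y)) (\<Phi> (g [^] n \<otimes> inv h) (\<Phi> h N)) < 2 * e"
        using close[OF c(2)[OF y(2)], of "g [^] n \<otimes> inv h"] h by simp
      then show False using n h by (simp add: m_assoc e_def)
    qed
  qed (use d1 d2 in auto)
qed

end

section \<open>Lines of primitive elements\<close>

lemma strict_suffixE_append:
  assumes "strict_suffix v r" obtains v' where "r = v' @ v" "v' \<noteq> []"
  using assms by (cases "r = v") (auto simp: strict_suffix_def suffix_def)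

context free_group
begin

text \<open>Cyclically reduced and not a proper power. Since commuting words are powers of a common
  word, the last clause is primitivity, in the form in which \<open>line_from_prefix\<close>
  contradicts it.\<close>

definition primitive_cyclic :: "('a \<times> bool) list \<Rightarrow> bool"
  where "primitive_cyclic r \<longleftrightarrow> r \<in> lists letters \<and> r \<noteq> [] \<and> reduced_word (r @ r) \<and>
    (\<forall>v. v \<noteq> [] \<and> length v < length r \<longrightarrow> v @ r \<noteq> r @ v)"

lemma primitive_cyclicD:
  assumes "primitive_cyclic r"
  shows "r \<in> lists letters" "r \<noteq> []" "reduced_word (r @ r)" "reduced_word r" "val r \<in> carrier G"
    "hd r \<noteq> flip (last r)" "hd r \<noteq> hd (winv r)"
    "v \<noteq> [] \<Longrightarrow> length v < length r \<Longrightarrow> v @ r \<noteq> r @ v"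
  using assms by (auto simp: primitive_cyclic_def reduced_append hd_winv)

lemma primitive_cyclic_winv:
  assumes "primitive_cyclic r" shows "primitive_cyclic (winv r)"
proof -
  have "v @ winv r \<noteq> winv r @ v" if "v \<noteq> []" "length v < length r" for v
  proof
    assume "v @ winv r = winv r @ v"
    then have "winv (v @ winv r) = winv (winv r @ v)" by simp
    then have "winv v @ r = r @ winv v" by simp
    then show False using primitive_cyclicD(8)[OF assms, of "winv v"] that by simp
  qed
  moreover have "reduced_word (winv r @ winv r)"
    using primitive_cyclicD(3)[OF assms] reduced_winv[of "r @ r"] by simp
  ultimately show ?thesis
    using primitive_cyclicD(1,2)[OF assms] by (auto simp: primitive_cyclic_def simp del: in_lists_conv_set)
qed

lemma concat_replicate_lists: "r \<in> lists A \<Longrightarrow> concat (replicate k r) \<in> lists A"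
  by (induction k) auto

lemma val_power: "r \<in> lists letters \<Longrightarrow> val (concat (replicate k r)) = val r [^] k"
proof (induction k)
  case (Suc k)
  have "val (concat (replicate (Suc k) r)) = val r \<otimes> val r [^] k"
    using Suc concat_replicate_lists[OF Suc.prems] by (simp add: val_append)
  then show ?case using nat_pow_Suc2[OF val_closed[OF Suc.prems]] by simp
qed simp

text \<open>Nothing cancels, because the word is a suffix of the power \<open>Suc k\<close> of
  \<open>r\<close>.\<close>

lemma nf_line_nonneg:
  assumes r: "primitive_cyclic r" and v: "r = v' @ v"
  shows "nf (val v \<otimes> val r [^] int k) = v @ concat (replicate k r)"
proof -
  have l: "v \<in> lists letters" "concat (replicate k r) \<in> lists letters"
    using primitive_cyclicD(1)[OF r] v concat_replicate_lists by (metis append_in_lists_conv)+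
  have "v' @ (v @ concat (replicate k r)) = concat (replicate (Suc k) r)"
    using v by simp
  then have "reduced_word (v @ concat (replicate k r))"
    using reduced_power[OF primitive_cyclicD(3)[OF r], of "Suc k"] by (metis reduced_append)
  then show ?thesis
    using nf_val l val_append[OF l] val_power[OF primitive_cyclicD(1)[OF r]]
    by (metis append_in_lists_conv int_pow_int)
qed

text \<open>One inverse copy of \<open>r\<close> absorbs \<open>v\<close> and leaves
  \<open>winv v'\<close>; hence exponent \<open>Suc k\<close> on the left but only \<open>k\<close>
  copies on the right.\<close>

lemma nf_line_neg:
  assumes r: "primitive_cyclic r" and v: "r = v' @ v"
  shows "nf (val v \<otimes> val r [^] (- int (Suc k))) = winv v' @ concat (replicate k (winv r))"
proof -
  note rw = primitive_cyclicD[OF primitive_cyclic_winv[OF r]]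
  note rl = primitive_cyclicD(1)[OF r]
  have l: "v \<in> lists letters" "v' \<in> lists letters" "concat (replicate k (winv r)) \<in> lists letters"
    using rl rw(1) v concat_replicate_lists by (metis append_in_lists_conv)+
  have "winv v @ (winv v' @ concat (replicate k (winv r))) = concat (replicate (Suc k) (winv r))"
    using v by simp
  then have red: "reduced_word (winv v' @ concat (replicate k (winv r)))"
    using reduced_power[OF rw(3), of "Suc k"] by (metis reduced_append)
  have c: "val r [^] k \<in> carrier G" "val v \<in> carrier G" "val v' \<in> carrier G"
    using rl l by auto
  have "val r [^] (- int (Suc k)) = inv (val r [^] k \<otimes> (val v' \<otimes> val v))"
    using rl l v int_pow_neg_int[of "val r" "Suc k"] val_append by (metis nat_pow_Suc val_closed)
  also have "\<dots> = inv (val v) \<otimes> (inv (val v') \<otimes> inv (val r [^] k))"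
    using c by (simp add: inv_mult_group m_assoc)
  finally have "val v \<otimes> val r [^] (- int (Suc k)) = inv (val v') \<otimes> inv (val r [^] k)"
    using c by (simp flip: m_assoc)
  also have "inv (val r [^] k) = val (concat (replicate k (winv r)))"
    using rl val_power[OF rw(1)] val_winv nat_pow_inv by simp
  also have "inv (val v') \<otimes> val (concat (replicate k (winv r))) =
      val (winv v' @ concat (replicate k (winv r)))"
    using l val_winv val_append by simp
  finally show ?thesis using nf_val red l by simp
qed

text \<open>By \<open>nf_mult_right\<close>, a step by \<open>r\<close> can change the first letter
  only where the line meets a suffix of \<open>r\<close>. Meeting \<open>r\<close> itself is
  excluded too, as the previous point would be the identity, whose normal form is a strict
  suffix.\<close>

lemma line_dichotomy:
  assumes r: "primitive_cyclic r" and h: "h \<in> carrier G"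
    and off: "\<And>n::int. \<not> strict_suffix (nf (h \<otimes> val r [^] n)) r"
  shows "nf (h \<otimes> val r [^] (n::int)) \<noteq> [] \<and> hd (nf (h \<otimes> val r [^] n)) = hd (nf h)"
proof -
  note rc = primitive_cyclicD[OF r]
  have c: "h \<otimes> val r [^] n \<in> carrier G" for n :: int using h rc(5) by simp
  have nsuf: "\<not> suffix (nf (h \<otimes> val r [^] n)) r" for n :: int
  proof
    assume "suffix (nf (h \<otimes> val r [^] n)) r"
    then have "nf (h \<otimes> val r [^] n) = r" using off[of n] by (auto simp: strict_suffix_def)
    then have "h \<otimes> val r [^] n = val r" using val_nf[OF c] by metis
    then have "h \<otimes> val r [^] (n - 1) = \<one>"
      using h rc(5) by (simp add: int_pow_diff flip: m_assoc)
    then show False using off[of "n - 1"] rc(2) by (simp add: strict_suffix_def)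
  qed
  have step: "nf (h \<otimes> val r [^] n) \<noteq> []"
    "hd (nf (h \<otimes> val r [^] (n + 1))) = hd (nf (h \<otimes> val r [^] n))" for n :: int
  proof -
    have "h \<otimes> val r [^] n \<otimes> val r = h \<otimes> val r [^] (n + 1)"
      using h rc(5) by (simp add: int_pow_mult m_assoc)
    then show "nf (h \<otimes> val r [^] n) \<noteq> []"
      "hd (nf (h \<otimes> val r [^] (n + 1))) = hd (nf (h \<otimes> val r [^] n))"
      using nf_mult_right[OF c rc(1,4), of n] nsuf[of "n + 1"] by auto
  qed
  have "hd (nf (h \<otimes> val r [^] n)) = hd (nf h)"
  proof (induction n rule: int_induct[where k = 0])
    case base
    then show ?case using h by simp
  next
    case (step1 i)
    then show ?case using step(2)[of i] by simp
  next
    case (step2 i)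
    then show ?case using step(2)[of "i - 1"] by simp
  qed
  then show ?thesis using step(1) by blast
qed

text \<open>If the line met a strict suffix \<open>v\<close> of \<open>r\<close>, nonempty because
  \<open>q\<close> is off the axis, its normal forms would be explicit. A prefix \<open>r\<close> on
  the positive half makes \<open>v\<close> commute with \<open>r\<close>; on the negative half it
  makes \<open>v'\<close> its own inverse. So \<open>line_dichotomy\<close> applies.\<close>

lemma line_from_prefix:
  assumes r: "primitive_cyclic r" and q: "q \<in> carrier G" and off: "\<And>n::int. q \<noteq> val r [^] n"
    and pre: "prefix r (nf (q \<otimes> val r [^] (m::int)))"
  shows "nf (q \<otimes> val r [^] (n::int)) \<noteq> [] \<and> hd (nf (q \<otimes> val r [^] n)) = hd r"
proof -
  note rc = primitive_cyclicD[OF r]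
  have "\<not> strict_suffix (nf (q \<otimes> val r [^] k)) r" for k :: int
  proof
    assume suf: "strict_suffix (nf (q \<otimes> val r [^] k)) r"
    define v where "v = nf (q \<otimes> val r [^] k)"
    obtain v' where v': "r = v' @ v" "v' \<noteq> []"
      using suf unfolding v_def by (rule strict_suffixE_append)
    have qk: "val v = q \<otimes> val r [^] k" using q rc(5) val_nf by (simp add: v_def)
    have q': "q = val v \<otimes> val r [^] (- k)"
      using qk q rc(5) by (simp add: int_pow_neg m_assoc)
    have v0: "v \<noteq> []"
      using q' off[of "- k"] rc(5) by auto
    have len: "length v < length r" using v' by simp
    have qm: "q \<otimes> val r [^] m = val v \<otimes> val r [^] (m - k)"
      using qk q rc(5) by (simp add: int_pow_diff m_assoc flip: int_pow_mult)
        (simp add: int_pow_neg[symmetric] int_pow_mult[symmetric])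
    show False
    proof (cases "m - k" rule: int_cases)
      case (nonneg i)
      have pr: "prefix r (v @ concat (replicate i r))"
        using pre nf_line_nonneg[OF r v'(1), of i] qm nonneg by simp
      then obtain i' where i: "i = Suc i'" using prefix_length_le[OF pr] len by (cases i) auto
      then obtain zs where "(v @ r) @ concat (replicate i' r) = r @ zs"
        using pr by (auto elim: prefixE)
      from arg_cong[OF this, of "take (length r)"] have "take (length r) (v @ r) = r" by simp
      then obtain y where y: "v @ r = r @ y" by (metis append_take_drop_id)
      \<comment> \<open>Both sides have the same length, and the left one ends in \<open>v\<close>
        because \<open>r\<close> does.\<close>
      then have "v = y" using v' by (metis append_assoc append_eq_append_conv length_append add_left_cancel length_rotate add.commute)
      then show False using rc(8)[OF v0 len] y by simp
    next
      case (neg i)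
      then have "prefix r (winv v' @ concat (replicate i (winv r)))"
        using pre nf_line_neg[OF r v'(1), of i] qm by simp
      then obtain zs where "winv v' @ concat (replicate i (winv r)) = r @ zs"
        by (auto elim: prefixE)
      \<comment> \<open>Both words are compared on their first \<open>length v'\<close>
        letters.\<close>
      from arg_cong[OF this, of "take (length v')"] have "winv v' = v'" by (simp add: v'(1))
      moreover have "reduced_word v'" using rc(4) v'(1) by (simp add: reduced_append)
      ultimately show False using reduced_eq_winv v'(2) by blast
    qed
  qed
  from line_dichotomy[OF r q this]
  have *: "nf (q \<otimes> val r [^] n) \<noteq> [] \<and> hd (nf (q \<otimes> val r [^] n)) = hd (nf q)" for n :: int
    by blast
  have "hd (nf (q \<otimes> val r [^] m)) = hd r"
    using pre rc(2) by (auto simp: prefix_def)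
  then show ?thesis using * by metis
qed

text \<open>A line through the root has one exit letter for each end, any other line only one in
  all. With four letters available, this leaves room for a translation in
  \<open>lead_translate\<close>.\<close>

lemma line_first_letters:
  assumes r: "primitive_cyclic r" and h: "h \<in> carrier G"
  shows "\<exists>s t. \<forall>n::int. nf (h \<otimes> val r [^] n) \<noteq> [] \<longrightarrow> hd (nf (h \<otimes> val r [^] n)) \<in> {s, t}"
proof (cases "\<exists>n::int. strict_suffix (nf (h \<otimes> val r [^] n)) r")
  case False
  then show ?thesis using line_dichotomy[OF r h] by blast
next
  case True
  then obtain k :: int where suf: "strict_suffix (nf (h \<otimes> val r [^] k)) r" by blast
  note rc = primitive_cyclicD[OF r]
  define v where "v = nf (h \<otimes> val r [^] k)"
  obtain v' where v': "r = v' @ v" "v' \<noteq> []"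
    using suf unfolding v_def by (rule strict_suffixE_append)
  have hk: "val v = h \<otimes> val r [^] k" using h rc(5) val_nf by (simp add: v_def)
  have "nf (h \<otimes> val r [^] n) \<noteq> [] \<longrightarrow>
      hd (nf (h \<otimes> val r [^] n)) \<in> {hd (v @ r), hd (winv v')}" for n :: int
  proof -
    have hn: "h \<otimes> val r [^] n = val v \<otimes> val r [^] (n - k)"
      using h rc(5) by (simp add: hk m_assoc flip: int_pow_mult)
    show ?thesis
    proof (cases "n - k" rule: int_cases)
      case (nonneg i)
      then show ?thesis
        using nf_line_nonneg[OF r v'(1), of i] hn rc(2) by (cases i) (auto simp: hd_append)
    next
      case (neg i)
      then show ?thesis
        using nf_line_neg[OF r v'(1), of i] hn v'(2) by (auto simp: hd_append)
    qed
  qed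
  then show ?thesis by blast
qed

end

section \<open>Separating the times along the axis\<close>

locale expansive_line = expansive_orbit G B \<Phi> S N g \<alpha>
  for G (structure) and B :: "'a set" and \<Phi> :: "'a \<Rightarrow> 'x::metric_space \<Rightarrow> 'x" and S :: "'a set"
    and N :: 'x and g :: 'a and \<alpha> :: real +
  fixes r :: "('a \<times> bool) list"
  assumes r: "primitive_cyclic r" and g_eq: "g = val r"
begin

lemmas rc = primitive_cyclicD[OF r]
lemmas dichotomy = line_dichotomy[OF r, folded g_eq]
lemmas from_prefix = line_from_prefix[OF r, folded g_eq]
lemmas line_nonneg = nf_line_nonneg[OF r, folded g_eq]
lemmas line_neg = nf_line_neg[OF r, folded g_eq]

section \<open>The two sides of the axis\<close>

lemma pow_add: "g [^] (m::int) \<otimes> g [^] (n::int) = g [^] (m + n)"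
  by (simp add: int_pow_mult)

lemma pow_add_right: "h \<in> carrier G \<Longrightarrow> h \<otimes> g [^] (m::int) \<otimes> g [^] (n::int) = h \<otimes> g [^] (m + n)"
  by (simp add: m_assoc pow_add)

lemma val_winv_r: "val (winv r) = inv g"
  using rc(1) by (simp add: val_winv g_eq)

text \<open>Used for \<open>w = r\<close> and \<open>w = winv r\<close>: lines other than the axis
  that reach the half-tree around its positive or negative end.\<close>

definition tree_side :: "('a \<times> bool) list \<Rightarrow> 'a set"
  where "tree_side w = {q \<in> carrier G. (\<forall>n::int. q \<noteq> g [^] n) \<and> (\<exists>n::int. prefix w (nf (q \<otimes> g [^] n)))}"

definition near_side :: "('a \<times> bool) list \<Rightarrow> real \<Rightarrow> 'x set"
  where "near_side w d = {x. \<exists>q\<in>tree_side w. dist x (\<Phi> q N) < d}"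

lemma near_side_mono: "x \<in> near_side w d \<Longrightarrow> d \<le> d' \<Longrightarrow> x \<in> near_side w d'"
  unfolding near_side_def by force

lemma near_side_triangle: "x \<in> near_side w d \<Longrightarrow> dist y x < d' \<Longrightarrow> y \<in> near_side w (d + d')"
proof -
  assume "x \<in> near_side w d" and y: "dist y x < d'"
  then obtain q where "q \<in> tree_side w" "dist x (\<Phi> q N) < d" by (auto simp: near_side_def)
  moreover then have "dist y (\<Phi> q N) < d + d'" using y dist_triangle[of y "\<Phi> q N" x] by linarith
  ultimately show ?thesis by (auto simp: near_side_def)
qed

lemma tree_side_hd:
  assumes w: "w = r \<or> w = winv r" and q: "q \<in> tree_side w"
  shows "nf (q \<otimes> g [^] (n::int)) \<noteq> [] \<and> hd (nf (q \<otimes> g [^] n)) = hd w"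
proof -
  from q obtain m :: int where q': "q \<in> carrier G" "\<And>n::int. q \<noteq> g [^] n" "prefix w (nf (q \<otimes> g [^] m))"
    by (auto simp: tree_side_def)
  show ?thesis
    using w
  proof
    assume "w = r"
    then show ?thesis using from_prefix[OF q'(1,2)] q'(3) by blast
  next
    assume w: "w = winv r"
    have pow: "val (winv r) [^] k = g [^] (- k)" for k :: int
      by (simp add: val_winv_r int_pow_inv int_pow_neg)
    \<comment> \<open>The base is now the inverse of \<open>g\<close>, so all exponents change
      sign.\<close>
    show ?thesis
      using line_from_prefix[OF primitive_cyclic_winv[OF r] q'(1), of "- m" "- n"] q'(2,3)
      by (simp add: pow w)
  qed
qed

text \<open>Multiplying by \<open>val w\<close> prepends another \<open>w\<close> without
  cancellation, as \<open>w\<close> is cyclically reduced; being a power of \<open>g\<close>, it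
  moves no other element onto the axis.\<close>

lemma tree_side_step:
  assumes w: "w = r \<or> w = winv r" and q: "q \<in> tree_side w"
  shows "val w \<otimes> q \<in> tree_side w"
proof -
  obtain s :: int where s: "val w = g [^] s"
  proof -
    have "val r = g [^] (1::int)" "val (winv r) = g [^] (-1::int)"
      using val_winv_r g_eq g_carrier int_pow_neg[of g 1] by simp_all
    then show ?thesis using w that by blast
  qed
  from q obtain m :: int where q': "q \<in> carrier G" "\<And>n::int. q \<noteq> g [^] n" "prefix w (nf (q \<otimes> g [^] m))"
    by (auto simp: tree_side_def)
  have "val w \<otimes> q \<noteq> g [^] n" for n :: int
  proof
    assume "val w \<otimes> q = g [^] n"
    then have "g [^] (- s) \<otimes> (g [^] s \<otimes> q) = g [^] (- s + n)" by (simp add: s pow_add)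
    then have "q = g [^] (- s + n)" using q'(1) by (simp add: pow_add flip: m_assoc)
    then show False using q'(2) by blast
  qed
  moreover have "prefix w (nf (val w \<otimes> q \<otimes> g [^] m))"
  proof -
    have pw: "primitive_cyclic w" using w r primitive_cyclic_winv by blast
    note wc = primitive_cyclicD[OF pw]
    have c: "q \<otimes> g [^] m \<in> carrier G" using q' by simp
    obtain y where y: "nf (q \<otimes> g [^] m) = w @ y" using q'(3) by (auto simp: prefix_def)
    have "reduced_word (w @ nf (q \<otimes> g [^] m))"
      using nf_reduced[OF c] wc by (auto simp: y reduced_append[of w "w @ y"])
    then have "nf (val w \<otimes> (q \<otimes> g [^] m)) = w @ nf (q \<otimes> g [^] m)"
      using nf_mult_reduced[OF wc(1) c] by blast
    then show ?thesis using wc(5) q'(1) by (simp add: m_assoc)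
  qed
  moreover have "val w \<otimes> q \<in> carrier G" using s q'(1) by simp
  ultimately show ?thesis unfolding tree_side_def by blast
qed

lemma tree_side_pow:
  assumes w: "w = r \<or> w = winv r" and q: "q \<in> tree_side w"
  shows "val w [^] (k::nat) \<otimes> q \<in> tree_side w"
proof (induction k)
  case 0
  then show ?case using q by (simp add: tree_side_def)
next
  case (Suc k)
  have "val w \<in> carrier G" "q \<in> carrier G"
    using w q rc(5) val_winv_r by (auto simp: tree_side_def)
  then have "val w [^] Suc k \<otimes> q = val w \<otimes> (val w [^] k \<otimes> q)"
    using nat_pow_Suc2 m_assoc nat_pow_closed by metis
  then show ?case using tree_side_step[OF w Suc] by simp
qed

text \<open>The inverse of a positive power of \<open>w\<close> begins with \<open>winv w\<close>,
  whereas every point on the line of \<open>q\<close> begins with \<open>hd w\<close>, a different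
  letter. So \<open>half_tree_stable\<close> applies, and the translate of \<open>q\<close> is again
  in \<open>tree_side w\<close>.\<close>

lemma near_side_stable:
  assumes w: "w = r \<or> w = winv r" and e: "0 < e" "e \<le> \<alpha>"
  shows "\<exists>d>0. d \<le> e \<and> (\<forall>x\<in>near_side w d. \<forall>k::nat. \<Phi> (val w [^] k) x \<in> near_side w e)"
proof -
  have pw: "primitive_cyclic w" using w r primitive_cyclic_winv by blast
  note wc = primitive_cyclicD[OF pw]
  have "winv w \<in> lists letters" using wc(1) by simp
  from half_tree_stable[OF e this] obtain d where d: "d > 0"
    "\<And>h z j. h \<in> carrier G \<Longrightarrow> (\<forall>n::int. \<not> prefix (winv w) (nf (h \<otimes> g [^] n))) \<Longrightarrow>
      dist z (\<Phi> h N) < d \<Longrightarrow> j \<in> carrier G \<Longrightarrow> prefix (winv w) (nf (inv j)) \<Longrightarrow>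
      dist (\<Phi> j z) (\<Phi> j (\<Phi> h N)) < e"
    by blast
  show ?thesis
  proof (intro exI[of _ "min d e"] conjI ballI allI)
    fix x and k :: nat
    assume "x \<in> near_side w (min d e)"
    then obtain q where q: "q \<in> tree_side w" "dist x (\<Phi> q N) < d" "dist x (\<Phi> q N) < e"
      by (auto simp: near_side_def)
    have qc: "q \<in> carrier G" using q by (simp add: tree_side_def)
    have jc: "val w [^] k \<in> carrier G" using wc(5) by simp
    have "dist (\<Phi> (val w [^] k) x) (\<Phi> (val w [^] k) (\<Phi> q N)) < e"
    \<comment> \<open>For \<open>k = 0\<close> the identity is outside the half-tree; this is why
      the radius is also bounded by \<open>e\<close>.\<close>
    proof (cases k)
      case 0
      then show ?thesis using q(3) by simp
    next
      case (Suc i)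
      have "concat (replicate k w) = concat (replicate i w) @ w"
        using Suc concat_replicate_add[of i 1 w] by simp
      then have "prefix (winv w) (winv (concat (replicate k w)))" by simp
      moreover have "\<not> prefix (winv w) (nf (q \<otimes> g [^] n))" for n :: int
      proof
        assume "prefix (winv w) (nf (q \<otimes> g [^] n))"
        then have "hd (nf (q \<otimes> g [^] n)) = hd (winv w)" using wc(2) by (auto simp: prefix_def)
        then show False using tree_side_hd[OF w q(1)] wc(7) by metis
      qed
      moreover have "nf (val w [^] k) = concat (replicate k w)"
        using nf_val[OF concat_replicate_lists[OF wc(1)] reduced_power[OF wc(3)]]
          val_power[OF wc(1)] by metis
      ultimately show ?thesis using d(2)[OF qc _ q(2) jc] nf_inv[OF jc] by metis
    qed
    then have "dist (\<Phi> (val w [^] k) x) (\<Phi> (val w [^] k \<otimes> q) N) < e"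
      using qc jc by simp
    then show "\<Phi> (val w [^] k) x \<in> near_side w e"
      using tree_side_pow[OF w q(1)] unfolding near_side_def by blast
  qed (use d e in auto)
qed

text \<open>Prefix sharing at depth one suffices: lines on opposite sides have different first
  letters throughout.\<close>

lemma near_sides_disjoint: "\<exists>e>0. near_side r e \<inter> near_side (winv r) e = {}"
proof -
  obtain d where d: "d > 0" "\<And>h q. h \<in> carrier G \<Longrightarrow> q \<in> carrier G \<Longrightarrow> dist (\<Phi> h N) (\<Phi> q N) < d \<Longrightarrow>
    \<exists>u (n::int) (n'::int). length u = 1 \<and> prefix u (nf (h \<otimes> g [^] n)) \<and> prefix u (nf (q \<otimes> g [^] n'))"
    using near_orbit_points_share_prefix[of 1] by blast
  have False if near: "x \<in> near_side r (d/2)" "x \<in> near_side (winv r) (d/2)" for x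
  proof -
    obtain h q where h: "h \<in> tree_side r" "dist x (\<Phi> h N) < d/2"
      and q: "q \<in> tree_side (winv r)" "dist x (\<Phi> q N) < d/2"
      using near unfolding near_side_def by blast
    have "dist (\<Phi> h N) (\<Phi> q N) < d" using h q dist_triangle_half_r by blast
    moreover have "h \<in> carrier G" "q \<in> carrier G" using h q by (auto simp: tree_side_def)
    ultimately obtain u and n n' :: int where u: "length u = 1" "prefix u (nf (h \<otimes> g [^] n))"
      "prefix u (nf (q \<otimes> g [^] n'))"
      using d(2) by blast
    then have "hd (nf (h \<otimes> g [^] n)) = hd u" "hd (nf (q \<otimes> g [^] n')) = hd u"
      by (auto simp: prefix_def hd_append)
    then show False
      using tree_side_hd[OF _ h(1)] tree_side_hd[OF _ q(1)] rc(7) by metis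
  qed
  then show ?thesis using d(1) by (intro exI[of _ "d/2"]) auto
qed

lemma orbit_shift: "\<Phi> (g [^] (k::int)) (\<Phi> (g [^] (n::int)) N) = \<Phi> (g [^] (k + n)) N"
  by (simp add: pow_add)

text \<open>
  Points near one side stay there in one time direction, so \<open>\<Theta>\<close> separates the times at which the
  \<open>g\<close>-orbit of \<open>N\<close> may be close to one side from those at which it may be close to the other; only
  the finitely many times in between need a smaller \<open>\<eta>\<close>.
\<close>

lemma time_partition:
  "\<exists>\<eta>>0. \<exists>\<Theta>::int set.
    (\<forall>m n. dist (\<Phi> (g [^] m) N) (\<Phi> (g [^] n) N) < \<eta> \<longrightarrow> (m \<in> \<Theta> \<longleftrightarrow> n \<in> \<Theta>)) \<and>
    (\<forall>n. \<Phi> (g [^] n) N \<in> near_side r \<eta> \<longrightarrow> n \<in> \<Theta>) \<and>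
    (\<forall>n. \<Phi> (g [^] n) N \<in> near_side (winv r) \<eta> \<longrightarrow> n \<notin> \<Theta>)"
proof -
  let ?a = "\<lambda>n::int. \<Phi> (g [^] n) N"
  obtain e' where e': "e' > 0" "near_side r e' \<inter> near_side (winv r) e' = {}"
    using near_sides_disjoint by blast
  define e where "e = min e' \<alpha>"
  have e: "e > 0" "e \<le> \<alpha>" using e' alpha_pos by (auto simp: e_def)
  have disj: "x \<notin> near_side (winv r) e" if "x \<in> near_side r e" for x
    using e'(2) near_side_mono that unfolding e_def by (meson disjoint_iff min.cobounded1)
  \<comment> \<open>Halving \<open>e\<close> leaves room for a further error below
    \<open>\<eta>\<close>, which will be at most \<open>e/2\<close>.\<close>
  obtain d1 where d1: "d1 > 0" "d1 \<le> e/2"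
    "\<And>x k. x \<in> near_side r d1 \<Longrightarrow> \<Phi> (val r [^] (k::nat)) x \<in> near_side r (e/2)"
    using near_side_stable[of r "e/2"] e by auto
  obtain d2 where d2: "d2 > 0" "d2 \<le> e/2"
    "\<And>x k. x \<in> near_side (winv r) d2 \<Longrightarrow> \<Phi> (val (winv r) [^] (k::nat)) x \<in> near_side (winv r) (e/2)"
    using near_side_stable[of "winv r" "e/2"] e by auto
  define d where "d = min d1 d2"
  have d: "d > 0" "d \<le> e/2" using d1 d2 by (auto simp: d_def)
  have fwd: "?a n \<in> near_side r (e/2)" if "?a m \<in> near_side r d" "m \<le> n" for m n
  proof -
    obtain k where k: "n = int k + m" using \<open>m \<le> n\<close> zle_iff_zadd by (metis add.commute)
    have "\<Phi> (g [^] k) (?a m) \<in> near_side r (e/2)"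
      using d1(3)[of "?a m" k] near_side_mono[OF that(1), of d1] by (simp add: d_def g_eq)
    then show ?thesis using orbit_shift[of "int k" m] k by (simp add: int_pow_int)
  qed
  have bwd: "?a n \<in> near_side (winv r) (e/2)" if "?a m \<in> near_side (winv r) d" "n \<le> m" for m n
  proof -
    obtain k where k: "n = - int k + m" using \<open>n \<le> m\<close> zle_iff_zadd by (metis add_diff_cancel_right' add.commute diff_conv_add_uminus)
    have "\<Phi> (inv g [^] k) (?a m) \<in> near_side (winv r) (e/2)"
      using d2(3)[of "?a m" k] near_side_mono[OF that(1), of d2] by (simp add: d_def val_winv_r)
    moreover have "inv g [^] k = g [^] (- int k)"
      by (simp add: int_pow_neg_int nat_pow_inv)
    ultimately show ?thesis using orbit_shift[of "- int k" m] k by simp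
  qed
  \<comment> \<open>If one side is never approached at scale \<open>d\<close>, a constant choice of
    \<open>\<Theta>\<close> works.\<close>
  consider "\<forall>n. ?a n \<notin> near_side r d" | "\<forall>n. ?a n \<notin> near_side (winv r) d"
    | n1 n2 where "?a n1 \<in> near_side r d" "?a n2 \<in> near_side (winv r) d"
    by blast
  then show ?thesis
  proof cases
    case 1
    then show ?thesis using d(1) by (intro exI[of _ d] conjI exI[of _ "{}"]) auto
  next
    case 2
    then show ?thesis using d(1) by (intro exI[of _ d] conjI exI[of _ "UNIV"]) auto
  next
    case (3 n1 n2)
    define \<Theta> where "\<Theta> = {n. ?a n \<notin> near_side (winv r) e}"
    \<comment> \<open>The least positive distance within the finite window of times. From
      \<open>n1\<close> on, the orbit stays near the positive side, and up to \<open>n2\<close> near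
      the negative one, so only inside the window can \<open>\<Theta>\<close> split close
      points.\<close>
    have "\<exists>c>0. \<forall>p\<in>{n2..n1}\<times>{n2..n1}. ?a (fst p) \<noteq> ?a (snd p) \<longrightarrow> c \<le> dist (?a (fst p)) (?a (snd p))"
    proof (rule finite_uniform_positive)
      fix p :: "int \<times> int"
      show "\<exists>c>0. ?a (fst p) \<noteq> ?a (snd p) \<longrightarrow> c \<le> dist (?a (fst p)) (?a (snd p))"
        by (cases "?a (fst p) = ?a (snd p)")
          (auto intro: exI[of _ 1] exI[of _ "dist (?a (fst p)) (?a (snd p))"])
    qed auto
    then obtain c where c: "c > 0" "\<And>m n. m \<in> {n2..n1} \<Longrightarrow> n \<in> {n2..n1} \<Longrightarrow> ?a m \<noteq> ?a n \<Longrightarrow>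
        c \<le> dist (?a m) (?a n)"
      by auto
    define \<eta> where "\<eta> = min c d"
    have \<eta>: "\<eta> > 0" "\<eta> \<le> c" "\<eta> \<le> d" using c d by (auto simp: \<eta>_def)
    have sep: "m \<notin> \<Theta>" if near: "dist (?a m) (?a n) < \<eta>" and n: "n \<notin> \<Theta>" for m n
    proof (rule ccontr)
      assume "\<not> m \<notin> \<Theta>"
      then have m: "?a m \<notin> near_side (winv r) e" by (simp add: \<Theta>_def)
      have n: "?a n \<in> near_side (winv r) e" using n by (simp add: \<Theta>_def)
      have "n < n1"
        using fwd[OF 3(1), of n] disj near_side_mono[of "?a n" r "e/2" e] n e by force
      have "n2 < m"
        using bwd[OF 3(2), of m] near_side_mono[of "?a m" _ "e/2" e] m e by force
      have "n2 < n"
      proof (rule ccontr)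
        assume "\<not> n2 < n"
        then have "?a m \<in> near_side (winv r) (e/2 + \<eta>)"
          using near_side_triangle[OF bwd[OF 3(2), of n] near] by simp
        then show False using m near_side_mono[of "?a m" _ "e/2 + \<eta>" e] \<eta> d by simp
      qed
      have "m < n1"
      proof (rule ccontr)
        assume "\<not> m < n1"
        then have "?a n \<in> near_side r (e/2 + \<eta>)"
          using near_side_triangle[OF fwd[OF 3(1), of m], of "?a n" \<eta>] near by (simp add: dist_commute)
        then show False using n disj near_side_mono[of "?a n" _ "e/2 + \<eta>" e] \<eta> d by force
      qed
      have "?a m \<noteq> ?a n" using m n by auto
      then have "c \<le> dist (?a m) (?a n)"
        using c(2)[of m n] \<open>n < n1\<close> \<open>n2 < m\<close> \<open>n2 < n\<close> \<open>m < n1\<close> by simp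
      then show False using near \<eta> by simp
    qed
    show ?thesis
    proof (intro exI[of _ \<eta>] conjI exI[of _ \<Theta>] allI impI)
      fix m n assume "dist (?a m) (?a n) < \<eta>"
      then show "m \<in> \<Theta> \<longleftrightarrow> n \<in> \<Theta>" using sep[of m n] sep[of n m] by (auto simp: dist_commute)
    next
      fix n assume "?a n \<in> near_side r \<eta>"
      then show "n \<in> \<Theta>" using disj near_side_mono[of "?a n" r \<eta> e] \<eta> d e by (auto simp: \<Theta>_def)
    next
      fix n assume "?a n \<in> near_side (winv r) \<eta>"
      then show "n \<notin> \<Theta>" using near_side_mono[of "?a n" _ \<eta> e] \<eta> d e by (auto simp: \<Theta>_def)
    qed (rule \<eta>(1))
  qed
qed

end

section \<open>A locally constant colouring\<close>

context expansive_line
begin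

text \<open>
  The line \<open>h\<langle>g\<rangle>\<close> crosses the root of the tree iff it is \<open>v\<langle>g\<rangle>\<close> with \<open>r = v' @ v\<close>; its two ends
  then leave the root through \<open>hd (v @ r)\<close> and \<open>hd (winv v')\<close>.
\<close>

definition crosses :: "'a \<Rightarrow> bool"
  where "crosses h \<longleftrightarrow> (\<exists>n::int. strict_suffix (nf (h \<otimes> g [^] n)) r)"

text \<open>The defining condition depends only on the line of \<open>h\<close>, so the choice is
  the same for all its points; \<open>time\<close> then locates \<open>h\<close> relative to this
  common base.\<close>

definition base :: "'a \<Rightarrow> ('a \<times> bool) list"
  where "base h = (SOME v. strict_suffix v r \<and> (\<exists>n::int. h = val v \<otimes> g [^] n))"

definition time :: "'a \<Rightarrow> int"
  where "time h = (SOME n. h = val (base h) \<otimes> g [^] n)"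

text \<open>The colour of \<open>h\<close>. In the last branch, the \<open>take\<close> recovers the
  complementary \<open>v'\<close> with \<open>r = v' @ base h\<close>.\<close>

definition lead :: "int set \<Rightarrow> 'a \<Rightarrow> 'a \<times> bool"
  where "lead \<Theta> h =
    (if \<not> crosses h then hd (nf h)
     else if time h \<in> \<Theta> then hd (base h @ r)
     else hd (winv (take (length r - length (base h)) r)))"

lemma strict_suffix_lists: "strict_suffix v r \<Longrightarrow> v \<in> lists letters"
  using rc(1) strict_suffixE_append append_in_lists_conv by metis

lemma base_time:
  assumes h: "h \<in> carrier G" and c: "crosses h"
  shows "strict_suffix (base h) r" "h = val (base h) \<otimes> g [^] time h"
proof -
  obtain n :: int where n: "strict_suffix (nf (h \<otimes> g [^] n)) r" using c by (auto simp: crosses_def)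
  have "val (nf (h \<otimes> g [^] n)) \<otimes> g [^] (- n) = h"
    using h val_nf by (simp add: pow_add_right)
  then have "\<exists>v. strict_suffix v r \<and> (\<exists>n::int. h = val v \<otimes> g [^] n)"
    using n by metis
  from someI_ex[OF this] have b: "strict_suffix (base h) r" "\<exists>n::int. h = val (base h) \<otimes> g [^] n"
    by (auto simp: base_def)
  show "strict_suffix (base h) r" by (rule b(1))
  show "h = val (base h) \<otimes> g [^] time h" unfolding time_def by (rule someI_ex[OF b(2)])
qed

lemma base_split:
  assumes "h \<in> carrier G" "crosses h"
  obtains v' where "r = v' @ base h" "v' \<noteq> []" "take (length r - length (base h)) r = v'"
  using strict_suffixE_append[OF base_time(1)[OF assms]] by (metis add_diff_cancel_right' append_eq_conv_conj length_append)

text \<open>On a crossing line the colours are realised at times 1 and -1, whose normal forms are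
  \<open>v @ r\<close> and \<open>winv v'\<close>; time 0 could be the root itself.\<close>

lemma lead_is_first_letter:
  assumes h: "h \<in> carrier G"
  shows "\<exists>n::int. nf (h \<otimes> g [^] n) \<noteq> [] \<and> lead \<Theta> h = hd (nf (h \<otimes> g [^] n))"
proof (cases "crosses h")
  case False
  then show ?thesis using dichotomy[OF h] unfolding crosses_def lead_def by metis
next
  case True
  obtain v' where v': "r = v' @ base h" "v' \<noteq> []" "take (length r - length (base h)) r = v'"
    using base_split[OF h True] by blast
  define v where "v = base h"
  have hv: "h = val v \<otimes> g [^] time h" using base_time[OF h True] by (simp add: v_def)
  have vc: "val v \<in> carrier G" using strict_suffix_lists base_time(1)[OF h True] by (simp add: v_def)
  have hn: "h \<otimes> g [^] (n - time h) = val v \<otimes> g [^] n" for n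
    using hv vc pow_add_right[OF vc] by (metis add.commute diff_add_cancel)
  have "nf (h \<otimes> g [^] (int 1 - time h)) = v @ r"
    using line_nonneg[OF v'(1), of 1] hn[of "int 1"] by (simp add: v_def)
  moreover have "nf (h \<otimes> g [^] (- int (Suc 0) - time h)) = winv v'"
    using line_neg[OF v'(1), of 0] hn[of "- int (Suc 0)"] by (simp add: v_def)
  moreover have "lead \<Theta> h \<in> {hd (v @ r), hd (winv v')}"
    using True v' by (auto simp: lead_def v_def)
  ultimately show ?thesis
    using v'(2) rc(2) by (metis append_is_Nil_conv empty_iff insert_iff winv_simps(5))
qed

text \<open>Both points share their base; translating by its inverse turns the comparison into one
  of two points of the \<open>g\<close>-orbit of \<open>N\<close>, at the two times separated by
  \<open>\<Theta>\<close>.\<close>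

lemma lead_same_line:
  assumes h: "h \<in> carrier G" and q: "q = h \<otimes> g [^] (l::int)"
    and \<Theta>: "\<And>m n. dist (\<Phi> (g [^] m) N) (\<Phi> (g [^] n) N) < \<eta> \<Longrightarrow> m \<in> \<Theta> \<longleftrightarrow> n \<in> \<Theta>"
    and near: "\<And>v. strict_suffix v r \<Longrightarrow>
      dist (\<Phi> (inv (val v)) (\<Phi> h N)) (\<Phi> (inv (val v)) (\<Phi> q N)) < \<eta>"
  shows "lead \<Theta> h = lead \<Theta> q"
proof -
  have qc: "q \<in> carrier G" using h q by simp
  have hq: "h = q \<otimes> g [^] (- l)" using h q by (simp add: pow_add_right)
  have line: "(\<exists>n::int. P (h \<otimes> g [^] n)) \<longleftrightarrow> (\<exists>n::int. P (q \<otimes> g [^] n))" for P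
    using h qc q hq pow_add_right by metis
  have cr: "crosses q \<longleftrightarrow> crosses h"
    unfolding crosses_def using line[of "\<lambda>x. strict_suffix (nf x) r"] by simp
  show ?thesis
  proof (cases "crosses h")
    case False
    then have "hd (nf q) = hd (nf h)"
      using dichotomy[OF h, of l] q unfolding crosses_def by simp
    then show ?thesis using False cr by (simp add: lead_def)
  next
    case True
    have "(\<exists>n::int. h = val v \<otimes> g [^] n) \<longleftrightarrow> (\<exists>n::int. q = val v \<otimes> g [^] n)"
      if "strict_suffix v r" for v
      using q hq pow_add_right[of "val v"] strict_suffix_lists[OF that] val_closed by metis
    then have "base q = base h" unfolding base_def by metis
    note b = base_time[OF h True] base_time(2)[OF qc, unfolded \<open>base q = base h\<close> cr, OF True]
    have vc: "val (base h) \<in> carrier G" using strict_suffix_lists b(1) by simp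
    have "\<Phi> (inv (val (base h))) (\<Phi> (val (base h) \<otimes> g [^] n) N) = \<Phi> (g [^] n) N" for n :: int
      using vc by (simp flip: m_assoc)
    then have "dist (\<Phi> (g [^] time h) N) (\<Phi> (g [^] time q) N) < \<eta>"
      using near[OF b(1)] b(2,3) by metis
    then show ?thesis
      using \<Theta> True cr \<open>base q = base h\<close> by (simp add: lead_def)
  qed
qed

text \<open>On a crossing line, \<open>u\<close> shows through which end the line of
  \<open>q\<close> follows that of \<open>h\<close>. Translated by the inverse of the base,
  \<open>q\<close> lies in \<open>tree_side r\<close> or \<open>tree_side (winv r)\<close>, so the
  orbit point at \<open>time h\<close> is near that side and \<open>\<Theta>\<close> selects the
  same end.\<close>

lemma lead_shared_prefix:
  assumes h: "h \<in> carrier G" and q: "q \<in> carrier G" and off: "\<And>l::int. q \<noteq> h \<otimes> g [^] l"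
    and \<Theta>: "\<And>n. \<Phi> (g [^] n) N \<in> near_side r \<eta> \<Longrightarrow> n \<in> \<Theta>"
      "\<And>n. \<Phi> (g [^] n) N \<in> near_side (winv r) \<eta> \<Longrightarrow> n \<notin> \<Theta>"
    and near: "\<And>v. strict_suffix v r \<Longrightarrow>
      dist (\<Phi> (inv (val v)) (\<Phi> h N)) (\<Phi> (inv (val v)) (\<Phi> q N)) < \<eta>"
    and u: "length u = 2 * length r" "prefix u (nf (h \<otimes> g [^] (m::int)))"
      "prefix u (nf (q \<otimes> g [^] (m'::int)))"
  shows "lead \<Theta> h = hd u"
proof -
  have u0: "u \<noteq> []" using u(1) rc(2) by auto
  show ?thesis
  proof (cases "crosses h")
    case False
    then have "hd (nf (h \<otimes> g [^] m)) = hd (nf h)"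
      using dichotomy[OF h, of m] unfolding crosses_def by blast
    then show ?thesis using False u(2) u0 by (auto simp: lead_def elim!: prefixE)
  next
    case True
    define v where "v = base h"
    note b = base_time[OF h True, folded v_def]
    obtain v' where v': "r = v' @ v" "v' \<noteq> []" "take (length r - length v) r = v'"
      using base_split[OF h True] unfolding v_def by blast
    have vl: "v \<in> lists letters" using strict_suffix_lists[OF b(1)] .
    have vc: "val v \<in> carrier G" using vl by simp
    define k where "k = time h + m"
    have hm: "h \<otimes> g [^] m = val v \<otimes> g [^] k"
      using b(2) pow_add_right[OF vc] by (metis k_def)
    define q' where "q' = inv (val v) \<otimes> q"
    have q'c: "q' \<in> carrier G" using vc q by (simp add: q'_def)
    have vq': "val v \<otimes> q' = q" using vc q by (simp add: q'_def flip: m_assoc)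
    have qm: "q' \<otimes> g [^] m' = inv (val v) \<otimes> (q \<otimes> g [^] m')"
      using vc q by (simp add: q'_def m_assoc)
    have q'off: "q' \<noteq> g [^] n" for n :: int
    proof
      assume "q' = g [^] n"
      then have "q = h \<otimes> g [^] (n - time h)"
        using vq' b(2) pow_add_right[OF vc] by (metis add.commute diff_add_cancel)
      then show False using off by blast
    qed
    have "\<Phi> (inv (val v)) (\<Phi> h N) = \<Phi> (g [^] time h) N"
      using vc h by (subst b(2)) (simp flip: m_assoc)
    then have nr: "dist (\<Phi> (g [^] time h) N) (\<Phi> q' N) < \<eta>"
      using near[OF b(1)] vc q by (simp add: q'_def)
    have side: "\<Phi> (g [^] time h) N \<in> near_side w \<eta>" if "prefix w (nf (q' \<otimes> g [^] m'))" for w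
      using that q'c q'off nr unfolding near_side_def tree_side_def by blast
    have len: "length r = length v' + length v" using v'(1) by simp
    have qc': "q \<otimes> g [^] m' \<in> carrier G" using q by simp
    show ?thesis
    proof (cases k rule: int_cases)
      case (nonneg i)
      have pr: "prefix u (v @ concat (replicate i r))"
        using u(2) line_nonneg[OF v'(1), of i] hm nonneg by simp
      then obtain i' where i: "i = Suc i'"
        using prefix_length_le[OF pr] u(1) len v'(2) by (cases i) auto
      have "prefix (v @ r) (v @ concat (replicate i r))" using i by simp
      \<comment> \<open>Depth \<open>2 * length r\<close> is enough for \<open>u\<close> to contain
        \<open>v @ r\<close>, as \<open>v\<close> is shorter than \<open>r\<close>.\<close>
      then have vr: "prefix (v @ r) u"
        using pr prefix_length_prefix u(1) len by (metis add_le_mono le_add2 length_append mult_2 order_refl)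
      then obtain y where "nf (q \<otimes> g [^] m') = v @ (r @ y)"
        using u(3) prefix_order.trans by (metis append.assoc prefixE)
      then have "nf (q' \<otimes> g [^] m') = r @ y" using nf_strip[OF qc'] qm by simp
      then have "time h \<in> \<Theta>" using side[of r] \<Theta>(1) by simp
      moreover have "hd (v @ r) = hd u" using vr rc(2) by (auto simp: hd_append elim!: prefixE)
      ultimately show ?thesis using True by (simp add: lead_def v_def)
    next
      case (neg i)
      have pr: "prefix u (winv v' @ concat (replicate i (winv r)))"
        using u(2) line_neg[OF v'(1), of i] hm neg by simp
      have vr: "prefix (winv v') u"
        using prefix_length_prefix[OF prefixI[OF refl] pr] u(1) len by simp
      then obtain y where y: "nf (q \<otimes> g [^] m') = winv v' @ y"
        using u(3) prefix_order.trans by (metis prefixE)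
      have "reduced_word (winv v @ winv v')"
        using rc(4) v'(1) reduced_winv[of r] by simp
      \<comment> \<open>The seam lies inside \<open>winv r\<close>; since \<open>winv v'\<close> is
        nonempty, \<open>y\<close> cannot affect it.\<close>
      then have "reduced_word (winv v @ (winv v' @ y))"
        using nf_reduced[OF qc'] y v'(2) by (simp add: reduced_append)
      then have "nf (val (winv v) \<otimes> (q \<otimes> g [^] m')) = winv v @ (winv v' @ y)"
        using nf_mult_reduced[OF _ qc', of "winv v"] vl y by simp
      then have "nf (q' \<otimes> g [^] m') = winv r @ y"
        using qm vl v'(1) by (simp add: val_winv)
      then have "time h \<notin> \<Theta>" using side[of "winv r"] \<Theta>(2) by simp
      moreover have "hd (winv v') = hd u" using vr v'(2) by (auto elim!: prefixE)
      ultimately show ?thesis using True v'(3) by (simp add: lead_def v_def)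
    qed
  qed
qed

text \<open>Points on one line are compared through \<open>\<Theta>\<close>; for different lines,
  both colours equal the first letter of a shared prefix.\<close>

lemma lead_locally_constant:
  "\<exists>\<Theta>. \<exists>\<delta>>0. \<forall>h\<in>carrier G. \<forall>q\<in>carrier G.
    dist (\<Phi> h N) (\<Phi> q N) < \<delta> \<longrightarrow> lead \<Theta> h = lead \<Theta> q"
proof -
  obtain \<eta> \<Theta> where \<eta>: "\<eta> > 0"
    and \<Theta>: "\<And>m n. dist (\<Phi> (g [^] m) N) (\<Phi> (g [^] n) N) < \<eta> \<Longrightarrow> m \<in> \<Theta> \<longleftrightarrow> n \<in> \<Theta>"
      "\<And>n::int. \<Phi> (g [^] n) N \<in> near_side r \<eta> \<Longrightarrow> n \<in> \<Theta>"
      "\<And>n::int. \<Phi> (g [^] n) N \<in> near_side (winv r) \<eta> \<Longrightarrow> n \<notin> \<Theta>"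
    using time_partition by blast
  define F where "F = (\<lambda>v. inv (val v)) ` {v. strict_suffix v r}"
  have "{v. strict_suffix v r} \<subseteq> set (suffixes r)" by (auto simp: strict_suffix_def)
  then have "finite F" unfolding F_def by (meson finite_imageI finite_set finite_subset)
  moreover have "F \<subseteq> carrier G" using strict_suffix_lists by (auto simp: F_def simp del: in_lists_conv_set)
  ultimately obtain d1 where d1: "d1 > 0"
      "\<And>f x y. f \<in> F \<Longrightarrow> dist x y < d1 \<Longrightarrow> dist (\<Phi> f x) (\<Phi> f y) < \<eta>"
    using act_uniform_finite[of F \<eta>] \<eta> by blast
  obtain d2 where d2: "d2 > 0" "\<And>h q. h \<in> carrier G \<Longrightarrow> q \<in> carrier G \<Longrightarrow>
    dist (\<Phi> h N) (\<Phi> q N) < d2 \<Longrightarrow> \<exists>u (n::int) (n'::int). length u = 2 * length r \<and>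
      prefix u (nf (h \<otimes> g [^] n)) \<and> prefix u (nf (q \<otimes> g [^] n'))"
    using near_orbit_points_share_prefix[of "2 * length r"] by blast
  show ?thesis
  proof (intro exI[of _ \<Theta>] exI[of _ "min d1 d2"] conjI ballI impI)
    fix h q assume h: "h \<in> carrier G" and q: "q \<in> carrier G"
      and near: "dist (\<Phi> h N) (\<Phi> q N) < min d1 d2"
    have nr: "dist (\<Phi> (inv (val v)) (\<Phi> h N)) (\<Phi> (inv (val v)) (\<Phi> q N)) < \<eta>"
      if "strict_suffix v r" for v
      using d1(2) near that by (simp add: F_def)
    show "lead \<Theta> h = lead \<Theta> q"
    proof (cases "\<exists>l::int. q = h \<otimes> g [^] l")
      case True
      then show ?thesis using lead_same_line[OF h _ \<Theta>(1) nr] by blast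
    next
      case False
      have "h \<noteq> q \<otimes> g [^] l" for l :: int
      proof
        assume "h = q \<otimes> g [^] l"
        then have "q = h \<otimes> g [^] (- l)" using q by (simp add: pow_add_right)
        then show False using False by blast
      qed
      note off = this
      obtain u and n n' :: int where u: "length u = 2 * length r"
        "prefix u (nf (h \<otimes> g [^] n))" "prefix u (nf (q \<otimes> g [^] n'))"
        using d2(2)[OF h q] near by auto
      have "lead \<Theta> h = hd u"
        using lead_shared_prefix[OF h q _ \<Theta>(2,3) nr u] False by blast
      moreover have "lead \<Theta> q = hd u"
        using lead_shared_prefix[OF q h off \<Theta>(2,3) _ u(1,3,2)] nr
        by (simp add: dist_commute)
      ultimately show ?thesis by simp
    qed
  qed (use d1 d2 in auto)
qed

text \<open>Some letter \<open>c\<close> cancels nowhere on the line of \<open>h\<close>, because at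
  most two first letters occur there. Prepending \<open>c\<close> makes it the colour; if that is
  the forbidden \<open>s\<close>, a second letter \<open>d\<close> in front changes it.\<close>

lemma lead_translate:
  assumes h: "h \<in> carrier G" and two: "a \<in> B" "b \<in> B" "a \<noteq> b"
  shows "\<exists>w \<in> lists letters. length w \<le> 2 \<and> lead \<Theta> (val w \<otimes> h) \<noteq> s"
proof -
  obtain s1 s2 where s12: "\<And>n::int. nf (h \<otimes> g [^] n) \<noteq> [] \<Longrightarrow> hd (nf (h \<otimes> g [^] n)) \<in> {s1, s2}"
    using line_first_letters[OF r h, folded g_eq] by blast
  have "\<exists>c \<in> {a, b} \<times> (UNIV::bool set). flip c \<notin> {s1, s2}"
  proof (rule ccontr)
    assume "\<not> ?thesis"
    then have "flip (a, True) \<in> {s1, s2}" "flip (a, False) \<in> {s1, s2}" "flip (b, True) \<in> {s1, s2}"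
      by auto
    then show False using two by (auto simp: flip_def)
  qed
  then obtain c where c: "c \<in> {a, b} \<times> UNIV" "flip c \<notin> {s1, s2}" by blast
  have cl: "c \<in> letters" using c two by auto
  have red: "reduced_word (c # nf (h \<otimes> g [^] n))" for n :: int
    using s12[of n] c(2) nf_reduced[of "h \<otimes> g [^] n"] h unfolding reduced_Cons by auto
  have lead_w: "lead \<Theta> (val w \<otimes> h) = hd w"
    if w: "w \<in> lists letters" "w \<noteq> []" "\<And>n::int. reduced_word (w @ nf (h \<otimes> g [^] n))" for w
  proof -
    have "val w \<otimes> h \<in> carrier G" using w h by simp
    then obtain n :: int where n: "lead \<Theta> (val w \<otimes> h) = hd (nf (val w \<otimes> h \<otimes> g [^] n))"
      using lead_is_first_letter by blast
    have "nf (val w \<otimes> h \<otimes> g [^] n) = w @ nf (h \<otimes> g [^] n)"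
      using nf_mult_reduced[OF w(1) _ w(3)] w(1) h by (simp add: m_assoc)
    then show ?thesis using n w(2) by simp
  qed
  show ?thesis
  proof (cases "c = s")
    case False
    then show ?thesis
      using lead_w[of "[c]"] red cl by (intro bexI[of _ "[c]"]) (auto simp del: word_value.simps)
  next
    case True
    obtain d where d: "d \<in> letters" "d \<noteq> c" "d \<noteq> flip c"
    proof (cases "fst c = a")
      case True
      then have "(b, True) \<noteq> c" "(b, True) \<noteq> flip c" using two by (auto simp: flip_def)
      then show ?thesis using that[of "(b, True)"] two by simp
    next
      case False
      then have "(a, True) \<noteq> c" "(a, True) \<noteq> flip c" by (auto simp: flip_def)
      then show ?thesis using that[of "(a, True)"] two by simp
    qed
    then have "reduced_word (d # c # nf (h \<otimes> g [^] n))" for n :: int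
      using red[of n] unfolding reduced_Cons[of d] by auto
    then have "lead \<Theta> (val [d, c] \<otimes> h) = d"
      using lead_w[of "[d, c]"] d(1) cl by (simp del: word_value.simps)
    then show ?thesis
      using d cl True by (intro bexI[of _ "[d, c]"]) (auto simp del: word_value.simps)
  qed
qed

lemma no_connected_invariant_set:
  assumes two: "a \<in> B" "b \<in> B" "a \<noteq> b"
    and M: "M \<noteq> {}" "connected M" "invariant_set G \<Phi> M" "M \<subseteq> closure (orbit G \<Phi> N)"
  shows False
proof -
  obtain \<Theta> \<delta> where \<delta>: "\<delta> > 0" "\<And>h q. h \<in> carrier G \<Longrightarrow> q \<in> carrier G \<Longrightarrow>
      dist (\<Phi> h N) (\<Phi> q N) < \<delta> \<Longrightarrow> lead \<Theta> h = lead \<Theta> q"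
    using lead_locally_constant by blast
  have approach: "\<exists>h\<in>carrier G. dist (\<Phi> h N) m < d" if "m \<in> M" "d > 0" for m d
  proof -
    have "m \<in> closure (orbit G \<Phi> N)" using that M(4) by blast
    then show ?thesis using \<open>d > 0\<close> unfolding closure_approachable orbit_def by blast
  qed
  \<comment> \<open>The translating word depends on \<open>h\<close>, and \<open>h\<close> must be
    chosen after \<open>d\<close>; so \<open>d\<close> has to serve all words of length at most
    two.\<close>
  define W where "W = val ` {w \<in> lists letters. length w \<le> 2}"
  have "finite W"
    using finite_lists_length_le[of letters 2] finite_basis by (simp add: W_def lists_eq_set)
  moreover have "W \<subseteq> carrier G" unfolding W_def using val_closed by blast
  ultimately obtain d where d: "d > 0"
      "\<And>j x y. j \<in> W \<Longrightarrow> dist x y < d \<Longrightarrow> dist (\<Phi> j x) (\<Phi> j y) < \<delta> / 2"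
    using act_uniform_finite[of W "\<delta>/2"] \<delta>(1) by auto
  obtain m where m: "m \<in> M" using M(1) by blast
  obtain h where h: "h \<in> carrier G" "dist (\<Phi> h N) m < min d (\<delta>/2)"
    using approach[OF m, of "min d (\<delta>/2)"] d(1) \<delta>(1) by auto
  \<comment> \<open>Radius \<open>\<delta>/2\<close> makes the two colour classes disjoint, since
    overlapping balls have centres closer than \<open>\<delta>\<close>.\<close>
  define U where "U = (\<Union>q\<in>{q \<in> carrier G. lead \<Theta> q = lead \<Theta> h}. ball (\<Phi> q N) (\<delta>/2))"
  define V where "V = (\<Union>q\<in>{q \<in> carrier G. lead \<Theta> q \<noteq> lead \<Theta> h}. ball (\<Phi> q N) (\<delta>/2))"
  obtain w where w: "w \<in> lists letters" "length w \<le> 2" "lead \<Theta> (val w \<otimes> h) \<noteq> lead \<Theta> h"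
    using lead_translate[OF h(1) two] by blast
  have wW: "val w \<in> W" and wc: "val w \<in> carrier G" using w by (auto simp: W_def simp del: in_lists_conv_set)
  have "open U" "open V" by (auto simp: U_def V_def)
  moreover have "U \<inter> V = {}"
  proof (rule ccontr)
    assume "U \<inter> V \<noteq> {}"
    then obtain x where "x \<in> U" "x \<in> V" by blast
    then obtain p q where pq: "p \<in> carrier G" "q \<in> carrier G" "lead \<Theta> p \<noteq> lead \<Theta> q"
      "dist (\<Phi> p N) x < \<delta>/2" "dist (\<Phi> q N) x < \<delta>/2"
      unfolding U_def V_def by (smt (verit) UN_E mem_Collect_eq mem_ball)
    then have "dist (\<Phi> p N) (\<Phi> q N) < \<delta>"
      using dist_triangle_half_r[of x "\<Phi> p N" \<delta> "\<Phi> q N"] by (simp add: dist_commute)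
    then show False using \<delta>(2) pq by blast
  qed
  moreover have "M \<subseteq> U \<union> V"
  proof
    fix x assume "x \<in> M"
    then obtain q where "q \<in> carrier G" "dist (\<Phi> q N) x < \<delta>/2"
      using approach[of x "\<delta>/2"] \<delta>(1) by auto
    then show "x \<in> U \<union> V" by (cases "lead \<Theta> q = lead \<Theta> h") (auto simp: U_def V_def)
  qed
  moreover have "m \<in> U \<inter> M" using m h by (auto simp: U_def)
  moreover have "\<Phi> (val w) m \<in> V \<inter> M"
  proof -
    have "\<Phi> (val w) m \<in> M" using M(3) m wc unfolding invariant_set_def by blast
    moreover have "dist (\<Phi> (val w \<otimes> h) N) (\<Phi> (val w) m) < \<delta>/2"
      using d(2)[OF wW, of "\<Phi> h N" m] h wc by simp
    moreover have "val w \<otimes> h \<in> carrier G" using wc h(1) by simp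
    ultimately show ?thesis using w(3) unfolding V_def by auto
  qed
  ultimately show False using connectedD[OF M(2), of U V] by blast
qed

end

section \<open>Reduction to primitive elements\<close>

context shadowing_free_action
begin

text \<open>As \<open>\<delta>\<close> is arbitrary, the local condition in the definition already
  covers every point other than \<open>N\<close>.\<close>

lemma expansive_point_iff:
  "expansive_point G \<Phi> g N \<longleftrightarrow>
    (\<exists>\<alpha>>0. \<forall>y. y \<noteq> N \<longrightarrow> (\<exists>n::int. dist (\<Phi> (g [^] n) y) (\<Phi> (g [^] n) N) > \<alpha>))"
proof -
  have "\<exists>\<delta>>0. dist y N < \<delta>" for y
    by (intro exI[of _ "dist y N + 1"]) (simp add: add_nonneg_pos)
  then show ?thesis unfolding expansive_point_def by (metis zero_less_dist_iff)
qed

text \<open>A modulus \<open>\<beta>\<close> for \<open>inv c\<close> turns separation by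
  \<open>\<alpha>\<close> into distance at least \<open>\<beta>\<close>; halving it restores the
  strict inequality.\<close>

lemma expansive_point_conj:
  assumes g: "g \<in> carrier G" and c: "c \<in> carrier G" and e: "expansive_point G \<Phi> g N"
  shows "expansive_point G \<Phi> (c \<otimes> g \<otimes> inv c) (\<Phi> c N)"
proof -
  obtain \<alpha> where \<alpha>: "\<alpha> > 0" "\<And>y. y \<noteq> N \<Longrightarrow> \<exists>n::int. dist (\<Phi> (g [^] n) y) (\<Phi> (g [^] n) N) > \<alpha>"
    using e unfolding expansive_point_iff by blast
  obtain \<beta> where \<beta>: "\<beta> > 0" "\<And>x y. dist x y < \<beta> \<Longrightarrow> dist (\<Phi> (inv c) x) (\<Phi> (inv c) y) < \<alpha>"
    using act_uniform_finite[of "{inv c}" \<alpha>] c \<alpha>(1) by auto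
  have cc: "inv c \<otimes> (c \<otimes> x) = x" if "x \<in> carrier G" for x
    using c that by (simp flip: m_assoc)
  have "(\<lambda>x. c \<otimes> x \<otimes> inv c) \<in> hom G G"
    by (rule homI) (use c cc in \<open>simp_all add: m_assoc\<close>)
  then have pow: "(c \<otimes> g \<otimes> inv c) [^] n = c \<otimes> g [^] n \<otimes> inv c" for n :: int
    using hom_int_pow[of "\<lambda>x. c \<otimes> x \<otimes> inv c" G G g n] g is_group by simp
  have conj: "\<Phi> (inv c) (\<Phi> ((c \<otimes> g \<otimes> inv c) [^] n) y) = \<Phi> (g [^] n) (\<Phi> (inv c) y)" for n :: int and y
    unfolding pow using c g cc by (simp add: m_assoc)
  show ?thesis
    unfolding expansive_point_iff
  proof (intro exI[of _ "\<beta> / 2"] conjI allI impI)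
    fix y assume "y \<noteq> \<Phi> c N"
    then have "\<Phi> (inv c) y \<noteq> N" using c act_inv(2) by metis
    then obtain n :: int where n: "dist (\<Phi> (g [^] n) (\<Phi> (inv c) y)) (\<Phi> (g [^] n) N) > \<alpha>"
      using \<alpha>(2) by blast
    have "\<not> dist (\<Phi> ((c \<otimes> g \<otimes> inv c) [^] n) y) (\<Phi> ((c \<otimes> g \<otimes> inv c) [^] n) (\<Phi> c N)) < \<beta>"
    proof
      assume "dist (\<Phi> ((c \<otimes> g \<otimes> inv c) [^] n) y) (\<Phi> ((c \<otimes> g \<otimes> inv c) [^] n) (\<Phi> c N)) < \<beta>"
      from \<beta>(2)[OF this] show False using n c by (simp only: conj act_inv)
    qed
    then show "\<exists>n::int. dist (\<Phi> ((c \<otimes> g \<otimes> inv c) [^] n) y)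
        (\<Phi> ((c \<otimes> g \<otimes> inv c) [^] n) (\<Phi> c N)) > \<beta> / 2"
      using \<beta>(1) by (intro exI[of _ n]) linarith
  qed (use \<beta>(1) in simp)
qed

lemma expansive_point_root:
  assumes f: "f \<in> carrier G" and e: "expansive_point G \<Phi> (f [^] (k::nat)) N"
  shows "expansive_point G \<Phi> f N"
proof -
  have "(f [^] k) [^] n = f [^] (int k * n)" for n :: int
    using int_pow_pow[OF f, of "int k" n] by (simp add: int_pow_int)
  then show ?thesis using e unfolding expansive_point_iff by metis
qed

lemma islimpt_translate:
  assumes c: "c \<in> carrier G" and N: "N islimpt UNIV"
  shows "\<Phi> c N islimpt UNIV"
  unfolding islimpt_approachable
proof (intro allI impI)
  fix e :: real assume "e > 0"
  then obtain d where d: "d > 0" "\<And>y. dist y N < d \<Longrightarrow> dist (\<Phi> c y) (\<Phi> c N) < e"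
    using act_uniform_finite[of "{c}" e] c by auto
  then obtain y where "y \<noteq> N" "dist y N < d" using N unfolding islimpt_approachable by blast
  then show "\<exists>y\<in>UNIV. y \<noteq> \<Phi> c N \<and> dist y (\<Phi> c N) < e"
    using d(2) act_inject[OF c] by blast
qed

lemma orbit_translate:
  assumes c: "c \<in> carrier G"
  shows "orbit G \<Phi> (\<Phi> c N) = orbit G \<Phi> N"
proof -
  have *: "orbit G \<Phi> (\<Phi> c N) \<subseteq> orbit G \<Phi> N" if "c \<in> carrier G" for c N
    using that unfolding orbit_def by (auto intro: m_closed)
  show ?thesis using *[OF c, of N] *[of "inv c" "\<Phi> c N"] c by simp
qed

text \<open>Conjugating by a letter and passing to a root both shorten the expansive group element.\<close>

lemma primitive_expansive_translate:
  assumes "g \<in> carrier G" "expansive_point G \<Phi> g N" "N islimpt UNIV"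
  shows "\<exists>c\<in>carrier G. \<exists>r. primitive_cyclic r \<and> expansive_point G \<Phi> (val r) (\<Phi> c N)"
  using assms
proof (induction "length (nf g)" arbitrary: g N rule: less_induct)
  case less
  define r where "r = nf g"
  have rl: "r \<in> lists letters" and red: "reduced_word r" and gr: "g = val r"
    using nf_lists nf_reduced val_nf less.prems(1) by (auto simp: r_def simp del: in_lists_conv_set)
  \<comment> \<open>The identity moves nothing apart, so it is not expansive at a limit
    point.\<close>
  have r0: "r \<noteq> []"
  proof
    assume "r = []"
    then obtain \<alpha> where "\<alpha> > 0" "\<And>y. y \<noteq> N \<Longrightarrow> dist y N > \<alpha>"
      using less.prems(2) gr unfolding expansive_point_iff by auto
    then show False using less.prems(3) unfolding islimpt_approachable by (meson not_less_iff_gr_or_eq)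
  qed
  consider "primitive_cyclic r" | "\<not> reduced_word (r @ r)"
    | v where "v \<noteq> []" "length v < length r" "v @ r = r @ v"
    using rl r0 unfolding primitive_cyclic_def by blast
  then show ?case
  proof cases
    case 1
    then show ?thesis using less.prems(2) gr by (intro bexI[of _ \<one>]) auto
  next
    case 2
    then have hl: "hd r = flip (last r)" using red by (auto simp: reduced_append)
    obtain l r1 where r1: "r = [l] @ r1 @ [flip l]"
    proof (cases r)
      case (Cons l r0)
      show ?thesis
      proof (cases r0 rule: rev_cases)
        case Nil
        then show ?thesis using hl Cons by simp
      next
        case (snoc r1 k)
        then have "k = flip l" using hl Cons by simp
        then show ?thesis using that Cons snoc by simp
      qed
    qed (use r0 in simp)
    have l: "[l] \<in> lists letters" "r1 \<in> lists letters" "reduced_word r1"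
      using rl red unfolding r1 reduced_append append_in_lists_conv by auto
    define c where "c = inv (val [l])"
    have lc: "val [l] \<in> carrier G" "val r1 \<in> carrier G" "c \<in> carrier G"
      using l by (auto simp: c_def simp del: word_value.simps in_lists_conv_set)
    have "g = val [l] \<otimes> (val r1 \<otimes> c)"
      using l val_append[of "[l]" "r1 @ [flip l]"] val_append[of r1 "[flip l]"] val_winv[of "[l]"]
      by (auto simp: gr r1 c_def flip_def simp del: word_value.simps)
    then have "c \<otimes> g \<otimes> inv c = val r1"
      using lc by (simp add: c_def m_assoc del: word_value.simps) (simp flip: m_assoc del: word_value.simps)
    then have e: "expansive_point G \<Phi> (val r1) (\<Phi> c N)"
      using expansive_point_conj[OF less.prems(1) lc(3) less.prems(2)] by simp
    have "length (nf (val r1)) < length (nf g)"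
      unfolding r_def[symmetric] nf_val[OF l(2,3)] r1 by simp
    then obtain c' r' where "c' \<in> carrier G" "primitive_cyclic r'"
        "expansive_point G \<Phi> (val r') (\<Phi> c' (\<Phi> c N))"
      using less.hyps[OF _ lc(2) e islimpt_translate[OF lc(3) less.prems(3)]] by blast
    then show ?thesis using lc(3) by (intro bexI[of _ "c' \<otimes> c"]) auto
  next
    case (3 v)
    \<comment> \<open>Commuting words are powers of a common \<open>z\<close>; as \<open>v\<close>
      is nonempty and shorter than \<open>r\<close>, the exponent \<open>n\<close> exceeds 1 and
      \<open>z\<close> is a shorter root.\<close>
    obtain m n z where z: "concat (replicate m z) = v" "concat (replicate n z) = r"
      using comm_append_are_replicate[OF 3(3)] by blast
    have len: "length v = m * length z" "length r = n * length z"
      using z by (auto simp: length_concat sum_list_replicate)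
    then have "n > 1" "length z > 0"
      using 3(1,2) by (cases m; cases n; auto)+
    then have zr: "length z < length r" using len by simp
    obtain n' where "n = Suc n'" using \<open>n > 1\<close> by (cases n) auto
    then have "r = z @ concat (replicate n' z)" using z(2) by simp
    then have zl: "z \<in> lists letters" "reduced_word z"
      using rl red by (auto simp: reduced_append simp del: in_lists_conv_set)
    have "g = val z [^] n" using gr z(2) val_power[OF zl(1)] by metis
    then have "expansive_point G \<Phi> (val z) N"
      using expansive_point_root[OF val_closed[OF zl(1)]] less.prems(2) by blast
    then show ?thesis
      using less.hyps[of "val z" N] nf_val[OF zl] zr less.prems(3) val_closed[OF zl(1)] by (simp add: r_def)
  qed
qed

end

text \<open>\<open>N\<close> is replaced by a translate at which a primitive cyclically reduced
  element is expansive. The orbit is unchanged, so the hypothesis on \<open>M\<close> carries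
  over.\<close>

theorem mainTheorem3:
  fixes G :: "('g, 'b) monoid_scheme"
    and \<Phi> :: "'g \<Rightarrow> 'x::metric_space \<Rightarrow> 'x"
    and B S :: "'g set" and N :: 'x and M :: "'x set" and g :: 'g
  assumes "dynamical_system G \<Phi>"
    and "free_basis G B" and "finite B" and "card B \<ge> 2"
    and "uniformly_continuous_generator G \<Phi> S"
    and "N islimpt UNIV"
    and "g \<in> carrier G" and "expansive_point G \<Phi> g N"
    and "M \<noteq> {}" and "connected M" and "invariant_set G \<Phi> M"
    and "M \<subseteq> closure (orbit G \<Phi> N)"
  shows "\<not> shadowing_property G \<Phi> S"
proof
  assume "shadowing_property G \<Phi> S"
  interpret group G using assms(1) by (simp add: dynamical_system_def)
  interpret shadowing_free_action G B \<Phi> S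
    by unfold_locales fact+
  obtain a b where ab: "a \<in> B" "b \<in> B" "a \<noteq> b"
    using assms(3,4) by (metis One_nat_def card_le_Suc0_iff_eq not_less_eq_eq numeral_2_eq_2)
  obtain c r where c: "c \<in> carrier G" and r: "primitive_cyclic r"
    and e: "expansive_point G \<Phi> (word_value G r) (\<Phi> c N)"
    using primitive_expansive_translate[OF assms(7,8,6)] by blast
  obtain \<alpha> where \<alpha>: "\<alpha> > 0" "\<And>y. y \<noteq> \<Phi> c N \<Longrightarrow> \<exists>n::int. dist (\<Phi> (word_value G r [^]\<^bsub>G\<^esub> n) y)
      (\<Phi> (word_value G r [^]\<^bsub>G\<^esub> n) (\<Phi> c N)) > \<alpha>"
    using e unfolding expansive_point_iff by blast
  interpret expansive_line G B \<Phi> S "\<Phi> c N" "word_value G r" \<alpha> r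
    using \<alpha> r primitive_cyclicD(5)[OF r] islimpt_translate[OF c assms(6)]
    by unfold_locales auto
  show False
    using no_connected_invariant_set[OF ab assms(9-11)] assms(12) orbit_translate[OF c] by metis
qed

end
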